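(* Let $(\mathcal{D}_a^{+},\mathcal{D}_a^{-})$ be a $g$-compatible pair of $a$-directional covariant derivative operators on $U$. Then it satisfies Leibniz-like rules for all suitable products: for all $X,Y\in\mathcal{M}(U)$, $$\mathcal{D}_a^{+}(X\underset{g}{\ast}Y)=(\mathcal{D}_a^{+}X)\underset{g}{\ast}Y+X\underset{g}{\ast}(\mathcal{D}_a^{+}Y),$$ $$\mathcal{D}_a^{-}(X\underset{g^{-1}}{\ast}Y)=(\mathcal{D}_a^{-}X)\underset{g^{-1}}{\ast}Y+X\underset{g^{-1}}{\ast}(\mathcal{D}_a^{-}Y),$$ where $\underset{g}{\ast}$ is any one of: the exterior product $\wedge$, the $g$-scalar product $\cdot_g$, the left or right $g$-contracted product $\lrcorner_g,\llcorner_g$, or the $g$-Clifford product; and analogously $\underset{g^{-1}}{\ast}$ with $g^{-1}$ in place of $g$.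
   Context: $M$ is an $n$-dimensional smooth manifold, $(U_o,\phi_o)$ a chart with coordinates $x^1,\dots,x^n$, and $U\subset U_o$ open. The canonical space $\mathcal{U}_o$ is an $n$-dimensional real vector space with basis $b_1,\dots,b_n$ and the Euclidean scalar product $b_\mu\cdot b_\nu=\delta_{\mu\nu}$, extended to $\bigwedge\mathcal{U}_o$ by $(v_1\wedge\dots\wedge v_k)\cdot(w_1\wedge\dots\wedge w_k)=\det(v_i\cdot w_j)$, different grades being orthogonal. $\mathcal{S}(U),\mathcal{V}(U),\mathcal{M}(U)$ denote smooth maps from $U$ to $\mathbb{R},\mathcal{U}_o,\bigwedge\mathcal{U}_o$. For $a\in\mathcal{U}_o$, $a\cdot\partial_o X=\sum_\mu(a\cdot b_\mu)\,\partial X/\partial x^\mu$ (componentwise). $\widetilde X$ is the reversion ($(-1)^{k(k-1)/2}$ on grade $k$). Contractions: $(X\lrcorner Y)\cdot Z=Y\cdot(\widetilde X\wedge Z)$, $(X\llcorner Y)\cdot Z=X\cdot(Z\wedge\widetilde Y)$ for all $Z$. ${}^\dagger$ is the Euclidean adjoint; $\underline t$ is the exterior-algebra extension of an endomorphism $t$. A connection field is a smooth map $\gamma$ on $U$ with values bilinear maps $\mathcal{U}_o\times\mathcal{U}_o\to\mathcal{U}_o$; $\gamma_a(b)=\gamma(a,b)$, $\Gamma_a(X)=\sum_\mu\gamma_a(b_\mu)\wedge(b_\mu\lrcorner X)$. The associated pair of $a$-directional covariant derivative operators is $\nabla_a^{+}X=a\cdot\partial_oX+\Gamma_a(X)$,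 $\nabla_a^{-}X=a\cdot\partial_oX-\Gamma_a^{\dagger}(X)$. A metric field $g$ is a smooth field of endomorphisms of $\mathcal{U}_o$ with $g=g^\dagger$, $\det[g]\ne0$ everywhere. The pair is $g$-compatible if $\nabla_a^{-}(g(b))-g(\nabla_a^{+}b)=0$ for all $b\in\mathcal{V}(U)$ and all $a$. For $m=g$ or $m=g^{-1}$: $X\cdot_mY=\underline m(X)\cdot Y$, $X\lrcorner_mY=\underline m(X)\lrcorner Y$, $X\llcorner_mY=X\llcorner\underline m(Y)$; the $m$-Clifford product is the associative bilinear product on multivectors for which scalars act by multiplication and, for vectors $b$, $bX=b\lrcorner_mX+b\wedge X$ and $Xb=X\llcorner_mb+X\wedge b$. *)

theory Defs
  imports "HOL-Analysis.Analysis"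
begin

section \<open>Smooth manifolds\<close>

text \<open>\<open>C\<^sup>k\<close> on an open subset of a finite-dimensional space: all iterated directional
  derivatives up to order \<open>k\<close> exist (as Frechet derivatives) and are continuous.\<close>

primrec Ck_on :: "nat \<Rightarrow> 'a::real_normed_vector set \<Rightarrow> ('a \<Rightarrow> 'b::real_normed_vector) \<Rightarrow> bool" where
  "Ck_on 0 S f \<longleftrightarrow> continuous_on S f"
| "Ck_on (Suc k) S f \<longleftrightarrow>
     (\<forall>x\<in>S. f differentiable (at x)) \<and> (\<forall>v. Ck_on k S (\<lambda>x. frechet_derivative f (at x) v))"

definition smooth_on :: "'a::real_normed_vector set \<Rightarrow> ('a \<Rightarrow> 'b::real_normed_vector) \<Rightarrow> bool" where
  "smooth_on S f \<longleftrightarrow> (\<forall>k. Ck_on k S f)"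

type_synonym 'n canon = "(real, 'n) vec"

text \<open>A chart is a pair of a domain and a coordinate map; the coordinate map is a total function
  whose values outside the domain are irrelevant.\<close>

type_synonym ('m, 'n) chart = "'m set \<times> ('m \<Rightarrow> 'n canon)"

abbreviation chart_dom :: "('m, 'n) chart \<Rightarrow> 'm set" where
  "chart_dom \<equiv> fst"

abbreviation chart_map :: "('m, 'n) chart \<Rightarrow> 'm \<Rightarrow> 'n canon" where
  "chart_map \<equiv> snd"

definition chart_inv :: "('m, 'n) chart \<Rightarrow> 'n canon \<Rightarrow> 'm" where
  "chart_inv c = inv_into (chart_dom c) (chart_map c)"

definition is_chart :: "'m topology \<Rightarrow> ('m, 'n::finite) chart \<Rightarrow> bool" where
  "is_chart M c \<longleftrightarrow>
     openin M (chart_dom c) \<and> open (chart_map c ` chart_dom c) \<and>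
     homeomorphic_map (subtopology M (chart_dom c))
       (top_of_set (chart_map c ` chart_dom c)) (chart_map c)"

definition smooth_transition :: "('m, 'n::finite) chart \<Rightarrow> ('m, 'n) chart \<Rightarrow> bool" where
  "smooth_transition c d \<longleftrightarrow>
     smooth_on (chart_map c ` (chart_dom c \<inter> chart_dom d)) (chart_map d \<circ> chart_inv c)"

definition smooth_manifold :: "'m topology \<Rightarrow> ('m, 'n::finite) chart set \<Rightarrow> bool" where
  "smooth_manifold M \<A> \<longleftrightarrow>
     Hausdorff_space M \<and> second_countable M \<and>
     (\<forall>c\<in>\<A>. is_chart M c) \<and> \<Union>(chart_dom ` \<A>) = topspace M \<and>
     (\<forall>c\<in>\<A>. \<forall>d\<in>\<A>. smooth_transition c d) \<and>
     (\<forall>c. is_chart M c \<and> (\<forall>d\<in>\<A>. smooth_transition c d \<and> smooth_transition d c) \<longrightarrow> c \<in> \<A>)"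

definition smooth_map_on ::
  "('m, 'n::finite) chart set \<Rightarrow> 'm set \<Rightarrow> ('m \<Rightarrow> 'b::real_normed_vector) \<Rightarrow> bool" where
  "smooth_map_on \<A> U f \<longleftrightarrow>
     (\<forall>c\<in>\<A>. smooth_on (chart_map c ` (U \<inter> chart_dom c)) (f \<circ> chart_inv c))"


section \<open>Multivectors over the canonical space\<close>

text \<open>The canonical space is \<open>real^'n\<close> with the basis \<open>b \<mu> = axis \<mu> 1\<close> and the library inner
  product.  Its exterior algebra is realised on the basis \<open>axis A 1\<close>, \<open>A\<close> a set of indices, which
  stands for \<open>b \<mu>\<^sub>1 \<and> \<dots> \<and> b \<mu>\<^sub>k\<close> where \<open>A = {\<mu>\<^sub>1 < \<dots> < \<mu>\<^sub>k}\<close> (see \<open>blade_basis\<close>).\<close>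

type_synonym 'n mv = "(real, 'n set) vec"

definition mv_scalar :: "real \<Rightarrow> 'n::finite mv" where
  "mv_scalar r = axis {} r"

definition mv_vector :: "'n canon \<Rightarrow> 'n::finite mv" where
  "mv_vector v = (\<Sum>\<mu>\<in>UNIV. v $ \<mu> *\<^sub>R axis {\<mu>} 1)"

text \<open>The sign of the permutation that sorts the concatenation of the increasing enumerations of
  \<open>A\<close> and \<open>B\<close>.\<close>

definition wedge_sign :: "'n::{finite,linorder} set \<Rightarrow> 'n set \<Rightarrow> real" where
  "wedge_sign A B = (- 1) ^ card {(i, j). i \<in> A \<and> j \<in> B \<and> j < i}"

definition wedge :: "'n::{finite,linorder} mv \<Rightarrow> 'n mv \<Rightarrow> 'n mv"  (infixr \<open>\<^bold>\<and>\<close> 75) where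
  "X \<^bold>\<and> Y = (\<chi> C. \<Sum>A\<in>Pow C. wedge_sign A (C - A) * X $ A * Y $ (C - A))"

primrec blade :: "('n::{finite,linorder} canon) list \<Rightarrow> 'n mv" where
  "blade [] = mv_scalar 1"
| "blade (v # vs) = mv_vector v \<^bold>\<and> blade vs"

text \<open>The scalar product of multivectors is the library inner product on \<open>'n mv\<close>: it is the one
  given by Gram determinants, with different grades orthogonal
  (see \<open>inner_blade_blade\<close> and \<open>inner_blade_blade_diff\<close>).\<close>

definition reversion :: "'n::{finite,linorder} mv \<Rightarrow> 'n mv" where
  "reversion X = (\<chi> A. (- 1) ^ (card A * (card A - 1) div 2) * X $ A)"

definition lcontr :: "'n::{finite,linorder} mv \<Rightarrow> 'n mv \<Rightarrow> 'n mv"  (infixr \<open>\<lrcorner>\<close> 75) where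
  "X \<lrcorner> Y = (THE W. \<forall>Z. W \<bullet> Z = Y \<bullet> (reversion X \<^bold>\<and> Z))"

definition rcontr :: "'n::{finite,linorder} mv \<Rightarrow> 'n mv \<Rightarrow> 'n mv"  (infixl \<open>\<llcorner>\<close> 75) where
  "X \<llcorner> Y = (THE W. \<forall>Z. W \<bullet> Z = X \<bullet> (Z \<^bold>\<and> reversion Y))"

text \<open>The exterior-algebra extension of an endomorphism \<open>t\<close>; see \<open>outermorphism_blade\<close>.\<close>

definition outermorphism ::
  "('n canon \<Rightarrow> 'n canon) \<Rightarrow> 'n::{finite,linorder} mv \<Rightarrow> 'n mv" where
  "outermorphism t X =
     (\<Sum>A\<in>UNIV. X $ A *\<^sub>R blade (map (\<lambda>\<mu>. t (axis \<mu> 1)) (sorted_list_of_set A)))"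


section \<open>Metric products\<close>

text \<open>In the following \<open>m\<close> is a symmetric endomorphism of the canonical space.\<close>

definition metric_scalar :: "('n canon \<Rightarrow> 'n canon) \<Rightarrow> 'n::{finite,linorder} mv \<Rightarrow> 'n mv \<Rightarrow> real" where
  "metric_scalar m X Y = outermorphism m X \<bullet> Y"

definition metric_lcontr :: "('n canon \<Rightarrow> 'n canon) \<Rightarrow> 'n::{finite,linorder} mv \<Rightarrow> 'n mv \<Rightarrow> 'n mv" where
  "metric_lcontr m X Y = outermorphism m X \<lrcorner> Y"

definition metric_rcontr :: "('n canon \<Rightarrow> 'n canon) \<Rightarrow> 'n::{finite,linorder} mv \<Rightarrow> 'n mv \<Rightarrow> 'n mv" where
  "metric_rcontr m X Y = X \<llcorner> outermorphism m Y"

definition is_clifford_product ::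
  "('n canon \<Rightarrow> 'n canon) \<Rightarrow> ('n::{finite,linorder} mv \<Rightarrow> 'n mv \<Rightarrow> 'n mv) \<Rightarrow> bool" where
  "is_clifford_product m P \<longleftrightarrow>
     bilinear P \<and>
     (\<forall>X Y Z. P (P X Y) Z = P X (P Y Z)) \<and>
     (\<forall>r X. P (mv_scalar r) X = r *\<^sub>R X \<and> P X (mv_scalar r) = r *\<^sub>R X) \<and>
     (\<forall>b X. P (mv_vector b) X = metric_lcontr m (mv_vector b) X + mv_vector b \<^bold>\<and> X \<and>
            P X (mv_vector b) = metric_rcontr m X (mv_vector b) + X \<^bold>\<and> mv_vector b)"

text \<open>Existence and uniqueness are shown in \<open>ex1_clifford_product\<close>.\<close>

definition clifford :: "('n canon \<Rightarrow> 'n canon) \<Rightarrow> 'n::{finite,linorder} mv \<Rightarrow> 'n mv \<Rightarrow> 'n mv" where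
  "clifford m = (THE P. is_clifford_product m P)"

text \<open>The suitable products, as functions of the metric.  The scalar product takes its values in
  the multivectors of grade 0.\<close>

definition suitable_products ::
  "(('n canon \<Rightarrow> 'n canon) \<Rightarrow> 'n::{finite,linorder} mv \<Rightarrow> 'n mv \<Rightarrow> 'n mv) set" where
  "suitable_products =
     {\<lambda>m. wedge, \<lambda>m X Y. mv_scalar (metric_scalar m X Y), metric_lcontr, metric_rcontr, clifford}"


section \<open>Covariant derivative operators\<close>

definition chart_partial ::
  "('m, 'n::finite) chart \<Rightarrow> 'n \<Rightarrow> ('m \<Rightarrow> 'b::real_normed_vector) \<Rightarrow> 'm \<Rightarrow> 'b" where
  "chart_partial c \<mu> X p =
     vector_derivative (\<lambda>s. X (chart_inv c (chart_map c p + s *\<^sub>R axis \<mu> 1))) (at 0)"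

definition dir_deriv ::
  "('m, 'n::finite) chart \<Rightarrow> 'n canon \<Rightarrow> ('m \<Rightarrow> 'b::real_normed_vector) \<Rightarrow> 'm \<Rightarrow> 'b" where
  "dir_deriv c a X p = (\<Sum>\<mu>\<in>UNIV. (a \<bullet> axis \<mu> 1) *\<^sub>R chart_partial c \<mu> X p)"

text \<open>Bilinear maps and endomorphisms of the (finite-dimensional) canonical space are elements of
  the normed spaces of bounded linear functions, so that smoothness applies to fields of them.\<close>

type_synonym ('m, 'n) conn = "'m \<Rightarrow> 'n canon \<Rightarrow>\<^sub>L ('n canon \<Rightarrow>\<^sub>L 'n canon)"

type_synonym ('m, 'n) endo_field = "'m \<Rightarrow> 'n canon \<Rightarrow>\<^sub>L 'n canon"

definition connection_field ::
  "('m, 'n::finite) chart set \<Rightarrow> 'm set \<Rightarrow> ('m, 'n) conn \<Rightarrow> bool" where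
  "connection_field \<A> U \<gamma> \<longleftrightarrow> smooth_map_on \<A> U \<gamma>"

definition Gam :: "('m, 'n::{finite,linorder}) conn \<Rightarrow> 'n canon \<Rightarrow> 'm \<Rightarrow> 'n mv \<Rightarrow> 'n mv" where
  "Gam \<gamma> a p X =
     (\<Sum>\<mu>\<in>UNIV. mv_vector (blinfun_apply (blinfun_apply (\<gamma> p) a) (axis \<mu> 1)) \<^bold>\<and>
                 (mv_vector (axis \<mu> 1) \<lrcorner> X))"

definition nabla_plus ::
  "('m, 'n::{finite,linorder}) chart \<Rightarrow> ('m, 'n) conn \<Rightarrow> 'n canon \<Rightarrow> ('m \<Rightarrow> 'n mv) \<Rightarrow> 'm \<Rightarrow> 'n mv" where
  "nabla_plus c \<gamma> a X p = dir_deriv c a X p + Gam \<gamma> a p (X p)"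

definition nabla_minus ::
  "('m, 'n::{finite,linorder}) chart \<Rightarrow> ('m, 'n) conn \<Rightarrow> 'n canon \<Rightarrow> ('m \<Rightarrow> 'n mv) \<Rightarrow> 'm \<Rightarrow> 'n mv" where
  "nabla_minus c \<gamma> a X p = dir_deriv c a X p - adjoint (Gam \<gamma> a p) (X p)"

definition metric_field ::
  "('m, 'n::finite) chart set \<Rightarrow> 'm set \<Rightarrow> ('m, 'n) endo_field \<Rightarrow> bool" where
  "metric_field \<A> U g \<longleftrightarrow>
     smooth_map_on \<A> U g \<and>
     (\<forall>p\<in>U. adjoint (blinfun_apply (g p)) = blinfun_apply (g p) \<and>
             det (matrix (blinfun_apply (g p))) \<noteq> 0)"

text \<open>The derivative of a vector field is a multivector field of grade 1, to which \<open>g\<close> is applied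
  through its extension \<open>outermorphism\<close> (see \<open>outermorphism_vector\<close>).\<close>

definition metric_compatible ::
  "('m, 'n::{finite,linorder}) chart set \<Rightarrow> 'm set \<Rightarrow> ('m, 'n) endo_field \<Rightarrow>
    ('n canon \<Rightarrow> ('m \<Rightarrow> 'n mv) \<Rightarrow> 'm \<Rightarrow> 'n mv) \<Rightarrow>
    ('n canon \<Rightarrow> ('m \<Rightarrow> 'n mv) \<Rightarrow> 'm \<Rightarrow> 'n mv) \<Rightarrow> bool" where
  "metric_compatible \<A> U g Dp Dm \<longleftrightarrow>
     (\<forall>b a. smooth_map_on \<A> U b \<longrightarrow>
        (\<forall>p\<in>U. Dm a (\<lambda>q. mv_vector (blinfun_apply (g q) (b q))) p
               - outermorphism (blinfun_apply (g p)) (Dp a (\<lambda>q. mv_vector (b q)) p) = 0))"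


section \<open>The encodings have their defining properties\<close>

subsection \<open>Exterior product and extension of endomorphisms\<close>

lemma wedge_sign_empty [simp]: "wedge_sign {} B = 1" "wedge_sign A {} = 1"
  by (simp_all add: wedge_sign_def)

lemma wedge_sign_Un_left:
  fixes A B C :: "'n::{finite,linorder} set"
  assumes "A \<inter> B = {}"
  shows "wedge_sign (A \<union> B) C = wedge_sign A C * wedge_sign B C"
proof -
  have "{(i, j). i \<in> A \<union> B \<and> j \<in> C \<and> j < i} =
      {(i, j). i \<in> A \<and> j \<in> C \<and> j < i} \<union> {(i, j). i \<in> B \<and> j \<in> C \<and> j < i}" by auto
  moreover have "{(i, j). i \<in> A \<and> j \<in> C \<and> j < i} \<inter> {(i, j). i \<in> B \<and> j \<in> C \<and> j < i} = {}"
    using assms by auto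
  ultimately show ?thesis
    by (simp add: wedge_sign_def card_Un_disjoint power_add)
qed

lemma wedge_sign_Un_right:
  fixes A B C :: "'n::{finite,linorder} set"
  assumes "B \<inter> C = {}"
  shows "wedge_sign A (B \<union> C) = wedge_sign A B * wedge_sign A C"
proof -
  have "{(i, j). i \<in> A \<and> j \<in> B \<union> C \<and> j < i} =
      {(i, j). i \<in> A \<and> j \<in> B \<and> j < i} \<union> {(i, j). i \<in> A \<and> j \<in> C \<and> j < i}" by auto
  moreover have "{(i, j). i \<in> A \<and> j \<in> B \<and> j < i} \<inter> {(i, j). i \<in> A \<and> j \<in> C \<and> j < i} = {}"
    using assms by auto
  ultimately show ?thesis
    by (simp add: wedge_sign_def card_Un_disjoint power_add)
qed

lemma wedge_sign_singletons: "wedge_sign {i} {j} = (if j < i then - 1 else 1)"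
proof -
  have "{(i', j'). i' \<in> {i} \<and> j' \<in> {j} \<and> j' < i'} = (if j < i then {(i, j)} else {})" by auto
  then show ?thesis by (simp add: wedge_sign_def)
qed

lemma wedge_sign_square [simp]: "wedge_sign A B * wedge_sign A B = 1"
  by (simp add: wedge_sign_def flip: power_add mult_2)

lemma wedge_sign_neq_0 [simp]: "wedge_sign A B \<noteq> 0"
  by (simp add: wedge_sign_def)

lemma wedge_sign_less:
  assumes "\<And>j. j \<in> B \<Longrightarrow> i < j"
  shows "wedge_sign {i} B = 1"
proof -
  have "{(i', j). i' \<in> {i} \<and> j \<in> B \<and> j < i'} = {}" using assms order_less_asym by blast
  then show ?thesis by (simp only: wedge_sign_def card.empty power_0)
qed

lemma mv_expand: "(X :: 'n::finite mv) = (\<Sum>A\<in>UNIV. X $ A *\<^sub>R axis A 1)"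
  by (simp add: vec_eq_iff axis_def if_distrib cong: if_cong)

lemma linear_eq_axis:
  fixes f g :: "(real, 'k::finite) vec \<Rightarrow> 'b::real_vector"
  assumes "linear f" "linear g" "\<And>A. f (axis A 1) = g (axis A 1)"
  shows "f X = g X"
proof -
  have X: "X = (\<Sum>A\<in>UNIV. X $ A *\<^sub>R axis A 1)"
    by (simp add: vec_eq_iff axis_def if_distrib cong: if_cong)
  have *: "h X = (\<Sum>A\<in>UNIV. X $ A *\<^sub>R h (axis A 1))" if lin: "linear h"
    for h :: "(real, 'k) vec \<Rightarrow> 'b"
  proof -
    have "h X = h (\<Sum>A\<in>UNIV. X $ A *\<^sub>R axis A 1)"
      using X by (rule arg_cong)
    also have "\<dots> = (\<Sum>A\<in>UNIV. X $ A *\<^sub>R h (axis A 1))"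
      by (simp only: linear_sum[OF lin] linear_scale[OF lin])
    finally show ?thesis .
  qed
  show ?thesis
    unfolding *[OF assms(1)] *[OF assms(2)] by (simp only: assms(3))
qed

lemma bilinear_wedge: "bilinear wedge"
  unfolding bilinear_def wedge_def
  by (auto intro!: linearI
      simp: vec_eq_iff algebra_simps sum.distrib sum_distrib_left)

lemma linear_wedge_right: "linear (wedge X)"
  by (rule bilinear_wedge[unfolded bilinear_def, THEN conjunct1, rule_format])

lemma linear_wedge_left: "linear (\<lambda>X. X \<^bold>\<and> Y)"
  by (rule bilinear_wedge[unfolded bilinear_def, THEN conjunct2, rule_format])

lemmas wedge_linear_simps =
  linear_add[OF linear_wedge_right] linear_add[OF linear_wedge_left]
  linear_scale[OF linear_wedge_right] linear_scale[OF linear_wedge_left]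
  linear_neg[OF linear_wedge_right] linear_neg[OF linear_wedge_left]
  linear_diff[OF linear_wedge_right] linear_diff[OF linear_wedge_left]
  linear_0[OF linear_wedge_right] linear_0[OF linear_wedge_left]
  linear_sum[OF linear_wedge_right] linear_sum[OF linear_wedge_left]

lemma wedge_axis:
  fixes A B :: "'n::{finite,linorder} set"
  shows "axis A 1 \<^bold>\<and> axis B 1 = (if A \<inter> B = {} then wedge_sign A B *\<^sub>R axis (A \<union> B) 1 else 0)"
proof -
  have "(\<Sum>D\<in>Pow C. wedge_sign D (C - D) * axis A 1 $ D * axis B 1 $ (C - D)) =
      (if A \<inter> B = {} \<and> C = A \<union> B then wedge_sign A B else 0)" (is "?l = _") for C
  proof -
    have "?l = (\<Sum>D\<in>Pow C. if D = A then wedge_sign A (C - A) * axis B 1 $ (C - A) else 0)"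
      by (intro sum.cong) (auto simp: axis_def)
    also have "\<dots> = (if A \<subseteq> C then wedge_sign A (C - A) * axis B 1 $ (C - A) else 0)"
      by (simp add: sum.delta)
    also have "\<dots> = (if A \<inter> B = {} \<and> C = A \<union> B then wedge_sign A B else 0)"
    proof -
      have "A \<subseteq> C \<and> C - A = B \<longleftrightarrow> A \<inter> B = {} \<and> C = A \<union> B" by blast
      then show ?thesis by (auto simp: axis_def)
    qed
    finally show ?thesis .
  qed
  then show ?thesis by (auto simp: vec_eq_iff wedge_def axis_def)
qed

lemma wedge_assoc:
  fixes X Y Z :: "'n::{finite,linorder} mv"
  shows "(X \<^bold>\<and> Y) \<^bold>\<and> Z = X \<^bold>\<and> (Y \<^bold>\<and> Z)"
proof -
  have basis: "(axis A 1 \<^bold>\<and> axis B 1) \<^bold>\<and> axis C 1 = axis A 1 \<^bold>\<and> (axis B 1 \<^bold>\<and> axis C 1)"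
    for A B C :: "'n set"
  proof (cases "A \<inter> B = {} \<and> A \<inter> C = {} \<and> B \<inter> C = {}")
    case True
    then have "A \<inter> (B \<union> C) = {}" "(A \<union> B) \<inter> C = {}" by blast+
    with True show ?thesis
      by (simp add: wedge_axis wedge_linear_simps wedge_sign_Un_left wedge_sign_Un_right
          Un_assoc mult.commute mult.left_commute)
  next
    case False
    then show ?thesis
      by (auto simp: wedge_axis wedge_linear_simps Int_Un_distrib Int_Un_distrib2)
  qed
  have 1: "(axis A 1 \<^bold>\<and> axis B 1) \<^bold>\<and> Z = axis A 1 \<^bold>\<and> (axis B 1 \<^bold>\<and> Z)" for A B :: "'n set" and Z
    by (rule linear_eq_axis[where f = "\<lambda>Z. (axis A 1 \<^bold>\<and> axis B 1) \<^bold>\<and> Z"])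
      (auto intro!: linearI simp: wedge_linear_simps basis)
  have 2: "(axis A 1 \<^bold>\<and> Y) \<^bold>\<and> Z = axis A 1 \<^bold>\<and> (Y \<^bold>\<and> Z)" for A :: "'n set" and Y Z
    by (rule linear_eq_axis[where f = "\<lambda>Y. (axis A 1 \<^bold>\<and> Y) \<^bold>\<and> Z"])
      (auto intro!: linearI simp: wedge_linear_simps 1)
  show ?thesis
    by (rule linear_eq_axis[where f = "\<lambda>X. (X \<^bold>\<and> Y) \<^bold>\<and> Z"])
      (auto intro!: linearI simp: wedge_linear_simps 2)
qed

lemma mv_scalar_eq: "mv_scalar r = r *\<^sub>R axis {} 1"
  by (simp add: mv_scalar_def vec_eq_iff axis_def)

lemma wedge_scalar: "mv_scalar r \<^bold>\<and> X = r *\<^sub>R X" "X \<^bold>\<and> mv_scalar r = r *\<^sub>R X"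
proof -
  have "axis {} 1 \<^bold>\<and> X = X" "X \<^bold>\<and> axis {} 1 = X"
    by (rule linear_eq_axis[where f = "\<lambda>X. axis {} 1 \<^bold>\<and> X"] linear_eq_axis[where f = "\<lambda>X. X \<^bold>\<and> axis {} 1"];
        auto intro!: linearI simp: wedge_linear_simps wedge_axis)+
  then show "mv_scalar r \<^bold>\<and> X = r *\<^sub>R X" "X \<^bold>\<and> mv_scalar r = r *\<^sub>R X"
    by (simp_all add: mv_scalar_eq wedge_linear_simps)
qed

lemma linear_mv_vector: "linear mv_vector"
  unfolding mv_vector_def
  by (auto intro!: linearI simp: scaleR_left_distrib sum.distrib scaleR_sum_right)

lemma mv_vector_axis [simp]: "mv_vector (axis \<mu> 1) = axis {\<mu>} 1"
proof -
  have "mv_vector (axis \<mu> 1) = (\<Sum>\<nu>\<in>UNIV. if \<nu> = \<mu> then axis {\<mu>} 1 else 0)"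
    unfolding mv_vector_def by (intro sum.cong) (auto simp: axis_def)
  then show ?thesis by simp
qed

lemma wedge_vector_anticomm:
  fixes v w :: "'n::{finite,linorder} canon"
  shows "mv_vector v \<^bold>\<and> mv_vector w = - (mv_vector w \<^bold>\<and> mv_vector v)"
proof -
  have basis: "axis {i} 1 \<^bold>\<and> axis {j} 1 = - (axis {j} 1 \<^bold>\<and> axis {i} 1)" for i j :: 'n
    by (cases i j rule: linorder_cases) (auto simp: wedge_axis wedge_sign_singletons insert_commute)
  have 1: "axis {i} 1 \<^bold>\<and> mv_vector w = - (mv_vector w \<^bold>\<and> axis {i} 1)" for i :: 'n and w
    by (rule linear_eq_axis[where f = "\<lambda>w. axis {i} 1 \<^bold>\<and> mv_vector w"])
      (auto intro!: linearI simp: wedge_linear_simps linear_add[OF linear_mv_vector]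
         linear_scale[OF linear_mv_vector] basis[of i])
  show ?thesis
    by (rule linear_eq_axis[where f = "\<lambda>v. mv_vector v \<^bold>\<and> mv_vector w"])
      (auto intro!: linearI simp: wedge_linear_simps linear_add[OF linear_mv_vector]
         linear_scale[OF linear_mv_vector] 1)
qed

lemma wedge_vector_self: "mv_vector v \<^bold>\<and> mv_vector v = 0"
  using wedge_vector_anticomm[of v v] by (simp add: eq_neg_iff_add_eq_0 flip: scaleR_2)

lemma wedge_vector_swap:
  "mv_vector v \<^bold>\<and> (mv_vector w \<^bold>\<and> X) = - (mv_vector w \<^bold>\<and> (mv_vector v \<^bold>\<and> X))"
  using wedge_vector_anticomm[of v w] by (simp add: wedge_linear_simps flip: wedge_assoc)

lemma wedge_vector_self2: "mv_vector v \<^bold>\<and> (mv_vector v \<^bold>\<and> X) = 0"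
  by (simp add: wedge_vector_self wedge_linear_simps flip: wedge_assoc)

lemma blade_basis: "blade (map (\<lambda>\<mu>. axis \<mu> 1) (sorted_list_of_set A)) = axis A 1"
proof -
  have "blade (map (\<lambda>\<mu>. axis \<mu> 1) xs) = axis (set xs) 1" if "sorted_wrt (<) xs" for xs :: "'a list"
    using that
  proof (induction xs)
    case (Cons x xs)
    then have "x \<notin> set xs" "wedge_sign {x} (set xs) = 1"
      by (auto intro: wedge_sign_less)
    with Cons show ?case by (simp add: wedge_axis)
  qed (simp add: mv_scalar_eq)
  from this[of "sorted_list_of_set A"] show ?thesis by simp
qed

lemma linear_outermorphism: "linear (outermorphism t)"
  unfolding outermorphism_def
  by (auto intro!: linearI simp: scaleR_left_distrib sum.distrib scaleR_sum_right)

lemma outermorphism_axis: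
  "outermorphism t (axis A 1) = blade (map (\<lambda>\<mu>. t (axis \<mu> 1)) (sorted_list_of_set A))"
proof -
  have "outermorphism t (axis A 1) =
    (\<Sum>B\<in>UNIV. if B = A then blade (map (\<lambda>\<mu>. t (axis \<mu> 1)) (sorted_list_of_set A)) else 0)"
    unfolding outermorphism_def by (intro sum.cong) (auto simp: axis_def)
  then show ?thesis by simp
qed

lemma outermorphism_wedge_vector:
  fixes t :: "'n::{finite,linorder} canon \<Rightarrow> 'n canon"
  assumes "linear t"
  shows "outermorphism t (mv_vector v \<^bold>\<and> X) = mv_vector (t v) \<^bold>\<and> outermorphism t X"
proof -
  define F where "F = (\<lambda>xs. blade (map (\<lambda>\<mu>. t (axis \<mu> 1)) xs))"
  have F: "mv_vector (t (axis i 1)) \<^bold>\<and> F xs =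
      (if i \<in> set xs then 0 else wedge_sign {i} (set xs) *\<^sub>R F (insort i xs))"
    if "sorted_wrt (<) xs" for i :: 'n and xs
    using that
  proof (induction xs)
    case Nil
    then show ?case by (simp add: F_def)
  next
    case (Cons x xs)
    consider "i < x" | "i = x" | "x < i" by fastforce
    then show ?case
    proof cases
      case 1
      with Cons.prems have "i \<notin> set (x # xs)" "wedge_sign {i} (set (x # xs)) = 1"
        by (auto intro!: wedge_sign_less)
      with 1 show ?thesis by (auto simp: F_def)
    next
      case 2
      then show ?thesis by (simp add: F_def wedge_vector_self2)
    next
      case 3
      have x: "x \<notin> set xs" using Cons.prems by auto
      have "wedge_sign {i} ({x} \<union> set xs) = - wedge_sign {i} (set xs)"
        using 3 x by (subst wedge_sign_Un_right) (auto simp: wedge_sign_singletons)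
      moreover have "mv_vector (t (axis i 1)) \<^bold>\<and> F (x # xs) =
          - (mv_vector (t (axis x 1)) \<^bold>\<and> (mv_vector (t (axis i 1)) \<^bold>\<and> F xs))"
        unfolding F_def by (simp add: wedge_vector_swap[of "t (axis i 1)"])
      ultimately show ?thesis using 3 Cons
        by (auto simp: wedge_linear_simps) (auto simp: F_def)
    qed
  qed
  have basis: "outermorphism t (axis {i} 1 \<^bold>\<and> axis A 1) =
      mv_vector (t (axis i 1)) \<^bold>\<and> outermorphism t (axis A 1)" for i A
    using F[of "sorted_list_of_set A" i]
    by (auto simp: wedge_axis outermorphism_axis linear_scale[OF linear_outermorphism]
        linear_0[OF linear_outermorphism] F_def)
  have 1: "outermorphism t (axis {i} 1 \<^bold>\<and> X) = mv_vector (t (axis i 1)) \<^bold>\<and> outermorphism t X" for i X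
    by (rule linear_eq_axis[where f = "\<lambda>X. outermorphism t (axis {i} 1 \<^bold>\<and> X)"])
      (auto intro!: linearI simp: wedge_linear_simps linear_add[OF linear_outermorphism]
         linear_scale[OF linear_outermorphism] basis)
  show ?thesis
    by (rule linear_eq_axis[where f = "\<lambda>v. outermorphism t (mv_vector v \<^bold>\<and> X)"])
      (auto intro!: linearI simp: wedge_linear_simps linear_add[OF linear_outermorphism]
         linear_scale[OF linear_outermorphism] linear_add[OF linear_mv_vector]
         linear_scale[OF linear_mv_vector] linear_add[OF assms] linear_scale[OF assms] 1)
qed

lemma outermorphism_scalar: "outermorphism t (mv_scalar r) = mv_scalar r"
  by (simp add: mv_scalar_eq linear_scale[OF linear_outermorphism] outermorphism_axis)

lemma outermorphism_blade:
  assumes "linear t"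
  shows "outermorphism t (blade vs) = blade (map t vs)"
  by (induction vs) (simp_all add: outermorphism_scalar outermorphism_wedge_vector[OF assms])

lemma outermorphism_vector:
  assumes "linear t"
  shows "outermorphism t (mv_vector v) = mv_vector (t v)"
  using outermorphism_blade[OF assms, of "[v]"] by (simp add: wedge_scalar)

subsection \<open>Scalar product, reversion and contractions\<close>

lemma inner_axis_axis_mv: "axis A (1::real) \<bullet> axis B 1 = (if A = B then 1 else 0)"
  by (simp add: inner_axis_axis)

lemma mv_eqI:
  fixes W W' :: "'n::finite mv"
  assumes "\<And>Z. W \<bullet> Z = W' \<bullet> Z"
  shows "W = W'"
  using assms vector_eq_rdot by blast

lemma reversion_axis: "reversion (axis A 1) = (- 1) ^ (card A * (card A - 1) div 2) *\<^sub>R axis A 1"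
  by (auto simp: vec_eq_iff reversion_def axis_def)

lemma linear_reversion: "linear reversion"
  unfolding reversion_def by (auto intro!: linearI simp: vec_eq_iff algebra_simps)

lemma reversion_vector [simp]: "reversion (mv_vector v) = mv_vector v"
proof (rule linear_eq_axis[where f = "\<lambda>v. reversion (mv_vector v)"])
  show "linear (\<lambda>v. reversion (mv_vector v))"
    using linear_compose[OF linear_mv_vector linear_reversion] by (simp add: o_def)
qed (simp_all add: linear_mv_vector reversion_axis)

lemma lcontr_eq_adjoint: "X \<lrcorner> Y = adjoint (wedge (reversion X)) Y"
  unfolding lcontr_def
proof (rule the_equality)
  show "\<forall>Z. adjoint (wedge (reversion X)) Y \<bullet> Z = Y \<bullet> (reversion X \<^bold>\<and> Z)"
    by (simp add: adjoint_clauses[OF linear_wedge_right])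
  show "W = adjoint (wedge (reversion X)) Y" if "\<forall>Z. W \<bullet> Z = Y \<bullet> (reversion X \<^bold>\<and> Z)" for W
    by (rule mv_eqI) (simp add: that adjoint_clauses[OF linear_wedge_right])
qed

lemma rcontr_eq_adjoint: "X \<llcorner> Y = adjoint (\<lambda>Z. Z \<^bold>\<and> reversion Y) X"
  unfolding rcontr_def
proof (rule the_equality)
  show "\<forall>Z. adjoint (\<lambda>Z. Z \<^bold>\<and> reversion Y) X \<bullet> Z = X \<bullet> (Z \<^bold>\<and> reversion Y)"
    by (simp add: adjoint_clauses[OF linear_wedge_left])
  show "W = adjoint (\<lambda>Z. Z \<^bold>\<and> reversion Y) X" if "\<forall>Z. W \<bullet> Z = X \<bullet> (Z \<^bold>\<and> reversion Y)" for W
    by (rule mv_eqI) (simp add: that adjoint_clauses[OF linear_wedge_left])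
qed

lemma inner_lcontr: "(X \<lrcorner> Y) \<bullet> Z = Y \<bullet> (reversion X \<^bold>\<and> Z)"
  by (simp add: lcontr_eq_adjoint adjoint_clauses[OF linear_wedge_right])

lemma inner_rcontr: "(X \<llcorner> Y) \<bullet> Z = X \<bullet> (Z \<^bold>\<and> reversion Y)"
  by (simp add: rcontr_eq_adjoint adjoint_clauses[OF linear_wedge_left])

lemma bilinear_lcontr: "bilinear lcontr"
  unfolding bilinear_def
  by (auto intro!: linearI mv_eqI simp: inner_lcontr inner_left_distrib wedge_linear_simps
      linear_add[OF linear_reversion] linear_scale[OF linear_reversion] inner_right_distrib)

lemma bilinear_rcontr: "bilinear rcontr"
  unfolding bilinear_def
  by (auto intro!: linearI mv_eqI simp: inner_rcontr inner_left_distrib wedge_linear_simps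
      linear_add[OF linear_reversion] linear_scale[OF linear_reversion] inner_right_distrib)

lemma linear_lcontr_right: "linear (lcontr X)"
  by (rule bilinear_lcontr[unfolded bilinear_def, THEN conjunct1, rule_format])

lemma linear_lcontr_left: "linear (\<lambda>X. X \<lrcorner> Y)"
  by (rule bilinear_lcontr[unfolded bilinear_def, THEN conjunct2, rule_format])

lemmas lcontr_linear_simps =
  linear_add[OF linear_lcontr_right] linear_add[OF linear_lcontr_left]
  linear_scale[OF linear_lcontr_right] linear_scale[OF linear_lcontr_left]
  linear_neg[OF linear_lcontr_right] linear_neg[OF linear_lcontr_left]
  linear_diff[OF linear_lcontr_right] linear_diff[OF linear_lcontr_left]
  linear_0[OF linear_lcontr_right] linear_0[OF linear_lcontr_left]
  linear_sum[OF linear_lcontr_right] linear_sum[OF linear_lcontr_left]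

lemma lcontr_axis:
  fixes A :: "'n::{finite,linorder} set"
  shows "axis {i} 1 \<lrcorner> axis A 1 =
    (if i \<in> A then wedge_sign {i} (A - {i}) *\<^sub>R axis (A - {i}) 1 else 0)"
proof (rule mv_eqI)
  fix Z :: "'n mv"
  have rev: "reversion (axis {i} 1) = axis {i} 1"
    by (simp add: reversion_axis)
  show "(axis {i} 1 \<lrcorner> axis A 1) \<bullet> Z =
      (if i \<in> A then wedge_sign {i} (A - {i}) *\<^sub>R axis (A - {i}) 1 else 0) \<bullet> Z"
  proof (rule linear_eq_axis[where X = Z])
    fix B
    have "(axis {i} 1 \<lrcorner> axis A 1) \<bullet> axis B 1 =
        (if i \<notin> B \<and> A = insert i B then wedge_sign {i} B else 0)"
      by (simp add: inner_lcontr rev wedge_axis inner_axis_axis_mv)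
    also have "\<dots> = (if i \<in> A \<and> B = A - {i} then wedge_sign {i} (A - {i}) else 0)"
    proof -
      have "i \<notin> B \<and> A = insert i B \<longleftrightarrow> i \<in> A \<and> B = A - {i}" by blast
      then show ?thesis by (simp only: cong: if_cong)
    qed
    also have "\<dots> = (if i \<in> A then wedge_sign {i} (A - {i}) *\<^sub>R axis (A - {i}) (1::real) else 0) \<bullet> axis B 1"
      by (simp add: inner_axis_axis eq_commute[of B])
    finally show "(axis {i} 1 \<lrcorner> axis A 1) \<bullet> axis B 1 =
        (if i \<in> A then wedge_sign {i} (A - {i}) *\<^sub>R axis (A - {i}) (1::real) else 0) \<bullet> axis B 1" .
  qed (auto intro!: linearI simp: inner_right_distrib algebra_simps)
qed

lemma lcontr_wedge_axis:
  fixes A :: "'n::{finite,linorder} set"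
  shows "axis {i} 1 \<lrcorner> (axis {j} 1 \<^bold>\<and> axis A 1) =
    (if i = j then 1 else 0) *\<^sub>R axis A 1 - axis {j} 1 \<^bold>\<and> (axis {i} 1 \<lrcorner> axis A 1)"
proof (cases "i = j")
  case True
  show ?thesis
  proof (cases "i \<in> A")
    case i: True
    then have "insert i (A - {i}) = A" by blast
    with True i show ?thesis by (simp add: wedge_axis lcontr_axis wedge_linear_simps lcontr_linear_simps)
  next
    case False
    with True show ?thesis
      by (simp add: wedge_axis lcontr_axis wedge_linear_simps lcontr_linear_simps)
  qed
next
  case ij: False
  show ?thesis
  proof (cases "i \<in> A \<and> j \<notin> A")
    case True
    then have i: "i \<in> A" and j: "j \<notin> A" by auto
    have 1: "wedge_sign {j} ({i} \<union> (A - {i})) = wedge_sign {j} {i} * wedge_sign {j} (A - {i})"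
      by (rule wedge_sign_Un_right) simp
    have 2: "wedge_sign {i} ({j} \<union> (A - {i})) = wedge_sign {i} {j} * wedge_sign {i} (A - {i})"
      using j by (intro wedge_sign_Un_right) simp
    have 3: "{i} \<union> (A - {i}) = A" "insert j A - {i} = {j} \<union> (A - {i})"
      using i ij by auto
    have 4: "wedge_sign {j} {i} * wedge_sign {i} {j} = - 1"
      using ij by (auto simp: wedge_sign_singletons)
    have "wedge_sign {j} A * wedge_sign {i} (insert j A - {i}) =
        (wedge_sign {j} {i} * wedge_sign {i} {j}) * (wedge_sign {j} (A - {i}) * wedge_sign {i} (A - {i}))"
      using 1 2 unfolding 3 by simp
    then have "wedge_sign {j} A * wedge_sign {i} (insert j A - {i}) =
        - (wedge_sign {j} (A - {i}) * wedge_sign {i} (A - {i}))"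
      unfolding 4 by simp
    with ij i j 3(2) show ?thesis
      by (simp add: wedge_axis lcontr_axis wedge_linear_simps lcontr_linear_simps)
  next
    case False
    with ij show ?thesis
      by (auto simp: wedge_axis lcontr_axis wedge_linear_simps lcontr_linear_simps)
  qed
qed

lemmas mv_vector_linear_simps =
  linear_add[OF linear_mv_vector] linear_scale[OF linear_mv_vector]
  linear_neg[OF linear_mv_vector] linear_diff[OF linear_mv_vector] linear_0[OF linear_mv_vector]

lemma lcontr_vector_wedge:
  fixes v w :: "'n::{finite,linorder} canon"
  shows "mv_vector v \<lrcorner> (mv_vector w \<^bold>\<and> X) = (v \<bullet> w) *\<^sub>R X - mv_vector w \<^bold>\<and> (mv_vector v \<lrcorner> X)"
proof -
  have 0: "axis {i} 1 \<lrcorner> (axis {j} 1 \<^bold>\<and> X) =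
    (if i = j then 1 else 0) *\<^sub>R X - axis {j} 1 \<^bold>\<and> (axis {i} 1 \<lrcorner> X)" for i j :: 'n and X
    by (rule linear_eq_axis[where f = "\<lambda>X. axis {i} 1 \<lrcorner> (axis {j} 1 \<^bold>\<and> X)"])
      (auto intro!: linearI simp: wedge_linear_simps lcontr_linear_simps algebra_simps
         lcontr_wedge_axis)
  have 1: "axis {i} 1 \<lrcorner> (mv_vector w \<^bold>\<and> X) =
    (axis i 1 \<bullet> w) *\<^sub>R X - mv_vector w \<^bold>\<and> (axis {i} 1 \<lrcorner> X)" for i :: 'n and w X
    by (rule linear_eq_axis[where f = "\<lambda>w. axis {i} 1 \<lrcorner> (mv_vector w \<^bold>\<and> X)"])
      (auto intro!: linearI simp: wedge_linear_simps lcontr_linear_simps algebra_simps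
         mv_vector_linear_simps inner_right_distrib 0 inner_axis_axis)
  show ?thesis
    by (rule linear_eq_axis[where f = "\<lambda>v. mv_vector v \<lrcorner> (mv_vector w \<^bold>\<and> X)"])
      (auto intro!: linearI simp: wedge_linear_simps lcontr_linear_simps algebra_simps
         mv_vector_linear_simps inner_left_distrib 1)
qed

lemma lcontr_vector_scalar: "mv_vector v \<lrcorner> mv_scalar r = 0"
  by (rule linear_eq_axis[where f = "\<lambda>v. mv_vector v \<lrcorner> mv_scalar r" and g = "\<lambda>v. 0"])
    (auto intro!: linearI simp: mv_scalar_eq lcontr_linear_simps mv_vector_linear_simps lcontr_axis scaleR_right_distrib)

lemma lcontr_vector_anticomm:
  "mv_vector v \<lrcorner> (mv_vector w \<lrcorner> X) = - (mv_vector w \<lrcorner> (mv_vector v \<lrcorner> X))"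
  by (rule mv_eqI) (simp add: inner_lcontr wedge_vector_swap[of v w])

lemma wedge_blade_vector:
  "blade vs \<^bold>\<and> mv_vector w = (- 1) ^ length vs *\<^sub>R (mv_vector w \<^bold>\<and> blade vs)"
proof (induction vs)
  case Nil
  then show ?case by (simp add: wedge_scalar)
next
  case (Cons v vs)
  have "blade (v # vs) \<^bold>\<and> mv_vector w = mv_vector v \<^bold>\<and> (blade vs \<^bold>\<and> mv_vector w)"
    by (simp add: wedge_assoc)
  also have "\<dots> = (- 1) ^ length (v # vs) *\<^sub>R (mv_vector w \<^bold>\<and> blade (v # vs))"
    by (simp add: Cons.IH wedge_linear_simps wedge_vector_swap[of v w])
  finally show ?case .
qed

lemma blade_append: "blade (vs @ ws) = blade vs \<^bold>\<and> blade ws"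
  by (induction vs) (simp_all add: wedge_scalar wedge_assoc)

lemma blade_repeat: "blade (xs @ v # ys @ v # zs) = 0"
proof -
  have "blade (v # ys @ v # zs) = mv_vector v \<^bold>\<and> ((blade ys \<^bold>\<and> mv_vector v) \<^bold>\<and> blade zs)"
    by (simp add: blade_append wedge_assoc)
  also have "\<dots> = 0"
    by (simp add: wedge_blade_vector wedge_linear_simps wedge_assoc wedge_vector_self2)
  finally show ?thesis by (simp only: blade_append wedge_linear_simps)
qed

lemma blade_swap: "blade (xs @ v # ys @ w # zs) = - blade (xs @ w # ys @ v # zs)"
  using blade_repeat[of xs "v + w" ys zs]
  by (simp add: blade_append mv_vector_linear_simps wedge_linear_simps
      blade_repeat[of xs v ys zs, simplified blade_append blade.simps]
      blade_repeat[of xs w ys zs, simplified blade_append blade.simps] eq_neg_iff_add_eq_0 add.commute)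

lemma upt_split2:
  assumes "k \<le> i" "i < j" "j < n"
  shows "[k..<n] = [k..<i] @ i # [Suc i..<j] @ j # [Suc j..<n]"
proof -
  have "[k..<n] = [k..<i] @ [i..<n]"
    using assms upt_add_eq_append[of k i "n - i"] by simp
  also have "[i..<n] = i # [Suc i..<n]"
    using assms by (simp add: upt_conv_Cons)
  also have "[Suc i..<n] = [Suc i..<j] @ [j..<n]"
    using assms upt_add_eq_append[of "Suc i" j "n - j"] by simp
  also have "[j..<n] = j # [Suc j..<n]"
    using assms by (simp add: upt_conv_Cons)
  finally show ?thesis .
qed

lemma blade_transpose:
  assumes "k \<le> i" "i < j" "j < n"
  shows "blade (map (w \<circ> Transposition.transpose i j) [k..<n]) = - blade (map w [k..<n])"
proof -
  have "map (w \<circ> Transposition.transpose i j) [a..<b] = map w [a..<b]" if "b \<le> i \<or> i < a \<and> b \<le> j \<or> j < a" for a b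
    using that assms by (auto simp: Transposition.transpose_def)
  from this[of i k] this[of j "Suc i"] this[of n "Suc j"]
  have "map (w \<circ> Transposition.transpose i j) [k..<n] =
      map w [k..<i] @ w j # map w [Suc i..<j] @ w i # map w [Suc j..<n]"
    using assms unfolding upt_split2[OF assms] by (simp add: Transposition.transpose_def)
  also have "blade \<dots> = - blade (map w [k..<n])"
    unfolding upt_split2[OF assms] by (simp add: blade_swap[of _ "w j"])
  finally show ?thesis .
qed

lemma lcontr_blade:
  assumes "m < n"
  shows "mv_vector v \<lrcorner> blade (map w [m..<n]) =
    (\<Sum>b\<in>{m..<n}. (sign (Transposition.transpose m b) * (v \<bullet> w b)) *\<^sub>R blade (map (w \<circ> Transposition.transpose m b) [Suc m..<n]))"
  using assms
proof (induction "n - m" arbitrary: m w)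
  case (Suc k)
  let ?B = "blade (map w [Suc m..<n])"
  have step: "mv_vector v \<lrcorner> blade (map w [m..<n]) =
      (v \<bullet> w m) *\<^sub>R ?B - mv_vector (w m) \<^bold>\<and> (mv_vector v \<lrcorner> ?B)"
    using Suc.prems by (simp add: upt_conv_Cons lcontr_vector_wedge)
  have "mv_vector (w m) \<^bold>\<and> (mv_vector v \<lrcorner> ?B) =
      (\<Sum>b\<in>{Suc m..<n}. (v \<bullet> w b) *\<^sub>R blade (map (w \<circ> Transposition.transpose m b) [Suc m..<n]))"
  proof (cases "Suc m < n")
    case False
    then have "n = Suc m" using Suc.prems by simp
    then show ?thesis by (simp add: lcontr_vector_scalar wedge_linear_simps)
  next
    case True
    have k: "k = n - Suc m" using Suc.hyps(2) by simp
    have *: "(sign (Transposition.transpose (Suc m) b) * (v \<bullet> w b)) *\<^sub>R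
          (mv_vector (w m) \<^bold>\<and> blade (map (w \<circ> Transposition.transpose (Suc m) b) [Suc (Suc m)..<n])) =
        (v \<bullet> w b) *\<^sub>R blade (map (w \<circ> Transposition.transpose m b) [Suc m..<n])"
      if b: "b \<in> {Suc m..<n}" for b
    proof (cases "b = Suc m")
      case True
      have "map (w \<circ> Transposition.transpose m b) [Suc m..<n] = w m # map w [Suc (Suc m)..<n]"
        using True \<open>Suc m < n\<close> by (simp add: upt_conv_Cons Transposition.transpose_def)
      with True show ?thesis by (simp add: sign_id)
    next
      case False
      with b have b': "Suc m < b" "b < n" by auto
      define u where "u = w \<circ> Transposition.transpose m b"
      have "map (u \<circ> Transposition.transpose (Suc m) b) [Suc m..<n] =
          w m # map (w \<circ> Transposition.transpose (Suc m) b) [Suc (Suc m)..<n]"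
        using True b' by (auto simp: upt_conv_Cons Transposition.transpose_def u_def)
      then have "mv_vector (w m) \<^bold>\<and> blade (map (w \<circ> Transposition.transpose (Suc m) b) [Suc (Suc m)..<n]) =
          blade (map (u \<circ> Transposition.transpose (Suc m) b) [Suc m..<n])"
        by simp
      also have "\<dots> = - blade (map u [Suc m..<n])"
        using b' by (intro blade_transpose) auto
      finally show ?thesis using b' by (simp add: u_def sign_swap_id)
    qed
    show ?thesis
      unfolding Suc.hyps(1)[OF k True] wedge_linear_simps
      by (intro sum.cong refl *)
  qed
  moreover have "(\<Sum>b\<in>{m..<n}. (sign (Transposition.transpose m b) * (v \<bullet> w b)) *\<^sub>R
        blade (map (w \<circ> Transposition.transpose m b) [Suc m..<n])) =
      (v \<bullet> w m) *\<^sub>R ?B - (\<Sum>b\<in>{Suc m..<n}. (v \<bullet> w b) *\<^sub>R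
        blade (map (w \<circ> Transposition.transpose m b) [Suc m..<n]))"
    using Suc.prems
    by (simp add: sum.atLeast_Suc_lessThan sign_swap_id sum_negf flip: sum_negf)
  ultimately show ?case unfolding step by simp
qed simp

lemma inner_blade_upt:
  assumes "m \<le> n"
  shows "blade (map v [m..<n]) \<bullet> blade (map w [m..<n]) =
    (\<Sum>p | p permutes {m..<n}. sign p * (\<Prod>i\<in>{m..<n}. v i \<bullet> w (p i)))"
  using assms
proof (induction "n - m" arbitrary: m w)
  case 0
  then show ?case by (simp add: mv_scalar_eq inner_axis_axis sign_id)
next
  case (Suc k)
  then have mn: "m < n" and k: "k = n - Suc m" "Suc m \<le> n" by auto
  have ins: "{m..<n} = insert m {Suc m..<n}" using mn by auto
  have "blade (map v [m..<n]) \<bullet> blade (map w [m..<n]) =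
      (mv_vector (v m) \<lrcorner> blade (map w [m..<n])) \<bullet> blade (map v [Suc m..<n])"
    using mn inner_lcontr[of "mv_vector (v m)" "blade (map w [m..<n])" "blade (map v [Suc m..<n])"]
    by (simp add: upt_conv_Cons inner_commute)
  also have "\<dots> = (\<Sum>b\<in>{m..<n}. sign (Transposition.transpose m b) * (v m \<bullet> w b) *
      (blade (map v [Suc m..<n]) \<bullet> blade (map (w \<circ> Transposition.transpose m b) [Suc m..<n])))"
    unfolding lcontr_blade[OF mn] inner_sum_left by (simp add: inner_commute)
  also have "\<dots> = (\<Sum>b\<in>{m..<n}. \<Sum>q | q permutes {Suc m..<n}.
      sign (Transposition.transpose m b \<circ> q) * (\<Prod>i\<in>{m..<n}. v i \<bullet> w ((Transposition.transpose m b \<circ> q) i)))"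
  proof (intro sum.cong refl)
    fix b assume "b \<in> {m..<n}"
    have "sign (Transposition.transpose m b \<circ> q) * (\<Prod>i\<in>{m..<n}. v i \<bullet> w ((Transposition.transpose m b \<circ> q) i)) =
        sign (Transposition.transpose m b) * (v m \<bullet> w b) *
        (sign q * (\<Prod>i\<in>{Suc m..<n}. v i \<bullet> (w \<circ> Transposition.transpose m b) (q i)))"
      if q: "q permutes {Suc m..<n}" for q
    proof -
      have "permutation q" using q by (auto simp: permutation_permutes)
      moreover have "q m = m" using q by (auto simp: permutes_def)
      ultimately show ?thesis
        unfolding ins by (simp add: sign_compose permutation_swap_id)
    qed
    then show "sign (Transposition.transpose m b) * (v m \<bullet> w b) *
        (blade (map v [Suc m..<n]) \<bullet> blade (map (w \<circ> Transposition.transpose m b) [Suc m..<n])) =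
      (\<Sum>q | q permutes {Suc m..<n}.
      sign (Transposition.transpose m b \<circ> q) * (\<Prod>i\<in>{m..<n}. v i \<bullet> w ((Transposition.transpose m b \<circ> q) i)))"
      unfolding Suc.hyps(1)[OF k] by (simp add: sum_distrib_left)
  qed
  also have "\<dots> = (\<Sum>p | p permutes {m..<n}. sign p * (\<Prod>i\<in>{m..<n}. v i \<bullet> w (p i)))"
    using sum_over_permutations_insert[of "{Suc m..<n}" m
        "\<lambda>p. sign p * (\<Prod>i\<in>{m..<n}. v i \<bullet> w (p i))"]
    by (simp add: ins)
  finally show ?case .
qed

lemma inner_blade_blade:
  assumes "length vs = k" "length ws = k"
  shows "blade vs \<bullet> blade ws =
    (\<Sum>p | p permutes {..<k}. of_int (sign p) * (\<Prod>i<k. vs ! i \<bullet> ws ! p i))"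
  using inner_blade_upt[of 0 k "nth vs" "nth ws"] map_nth[of vs] map_nth[of ws] assms
  by (simp add: atLeast0LessThan)

lemma blade_grade: "blade vs $ A \<noteq> 0 \<Longrightarrow> card A = length vs"
proof (induction vs arbitrary: A)
  case Nil
  then show ?case by (auto simp: mv_scalar_def axis_def split: if_splits)
next
  case (Cons v vs)
  then have "(\<Sum>B\<in>Pow A. wedge_sign B (A - B) * mv_vector v $ B * blade vs $ (A - B)) \<noteq> 0"
    by (simp add: wedge_def)
  then obtain B where B: "B \<subseteq> A" "mv_vector v $ B \<noteq> 0" "blade vs $ (A - B) \<noteq> 0"
    by (metis (no_types, lifting) Pow_iff mult_not_zero sum.not_neutral_contains_not_neutral)
  from B(2) have "card B = 1"
  proof -
    have "(\<Sum>\<mu>\<in>UNIV. v $ \<mu> * axis {\<mu>} 1 $ B) \<noteq> 0"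
      using B(2) by (simp add: mv_vector_def)
    then obtain \<mu> where "v $ \<mu> * axis {\<mu>} 1 $ B \<noteq> 0"
      by (rule sum.not_neutral_contains_not_neutral)
    then show ?thesis by (auto simp: axis_def split: if_splits)
  qed
  moreover have "card A = card B + card (A - B)"
    using B(1) by (metis Diff_partition Diff_disjoint card_Un_disjoint finite)
  ultimately show ?case using Cons.IH[OF B(3)] by simp
qed

lemma inner_blade_blade_diff:
  assumes "length vs \<noteq> length ws"
  shows "blade vs \<bullet> blade ws = 0"
  unfolding inner_vec_def
proof (rule sum.neutral, rule ballI)
  show "blade vs $ A \<bullet> blade ws $ A = 0" for A
    using assms blade_grade[of vs A] blade_grade[of ws A] by fastforce
qed

lemma reversion_blade: "reversion (blade vs) = blade (rev vs)"
proof -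
  have "reversion (blade vs) = (- 1) ^ (length vs * (length vs - 1) div 2) *\<^sub>R blade vs"
    unfolding reversion_def vec_eq_iff using blade_grade by fastforce
  also have "\<dots> = blade (rev vs)"
  proof (induction vs)
    case (Cons v vs)
    have "length (v # vs) * (length (v # vs) - 1) div 2 =
        length vs * (length vs - 1) div 2 + length vs"
      by (cases "length vs") (auto simp: algebra_simps)
    then show ?case
      by (simp add: blade_append wedge_scalar wedge_blade_vector wedge_linear_simps power_add
          Cons.IH[symmetric] del: mult_Suc)
  qed simp
  finally show ?thesis .
qed

subsection \<open>Existence and uniqueness of the Clifford product\<close>

definition involute :: "'n::{finite,linorder} mv \<Rightarrow> 'n mv" where
  "involute X = (\<chi> A. (- 1) ^ card A * X $ A)"

lemma involute_axis: "involute (axis A 1) = (- 1) ^ card A *\<^sub>R axis A 1"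
  by (auto simp: vec_eq_iff involute_def axis_def)

lemma linear_involute: "linear involute"
  unfolding involute_def by (auto intro!: linearI simp: vec_eq_iff algebra_simps)

lemmas involute_linear_simps =
  linear_add[OF linear_involute] linear_scale[OF linear_involute]
  linear_neg[OF linear_involute] linear_diff[OF linear_involute] linear_0[OF linear_involute]

lemma inner_involute: "involute X \<bullet> Y = X \<bullet> involute Y"
  by (auto simp: inner_vec_def involute_def intro!: sum.cong)

lemma involute_wedge_vector:
  fixes X :: "'n::{finite,linorder} mv"
  shows "involute (mv_vector v \<^bold>\<and> X) = - (mv_vector v \<^bold>\<and> involute X)"
proof -
  have 0: "involute (axis {i} 1 \<^bold>\<and> axis A 1) = - (axis {i} 1 \<^bold>\<and> involute (axis A 1))"
    for i :: 'n and A
    by (simp add: wedge_axis involute_axis involute_linear_simps wedge_linear_simps)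
  have 1: "involute (axis {i} 1 \<^bold>\<and> X) = - (axis {i} 1 \<^bold>\<and> involute X)" for i :: 'n and X
    by (rule linear_eq_axis[where f = "\<lambda>X. involute (axis {i} 1 \<^bold>\<and> X)"])
      (auto intro!: linearI simp: wedge_linear_simps involute_linear_simps 0)
  show ?thesis
    by (rule linear_eq_axis[where f = "\<lambda>v. involute (mv_vector v \<^bold>\<and> X)"])
      (auto intro!: linearI simp: wedge_linear_simps involute_linear_simps mv_vector_linear_simps 1)
qed

lemma wedge_vector_right:
  fixes X :: "'n::{finite,linorder} mv"
  shows "X \<^bold>\<and> mv_vector v = mv_vector v \<^bold>\<and> involute X"
proof (rule linear_eq_axis[where X = X])
  fix A :: "'n set"
  have "card A = length (map (\<lambda>\<mu>. axis \<mu> (1::real) :: 'n canon) (sorted_list_of_set A))" by simp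
  then show "axis A 1 \<^bold>\<and> mv_vector v = mv_vector v \<^bold>\<and> involute (axis A 1)"
    using wedge_blade_vector[of "map (\<lambda>\<mu>. axis \<mu> 1) (sorted_list_of_set A)" v]
    by (simp add: blade_basis involute_axis wedge_linear_simps)
qed (auto intro!: linearI simp: wedge_linear_simps involute_linear_simps)

lemma rcontr_vector: "X \<llcorner> mv_vector v = involute (mv_vector v \<lrcorner> X)"
  by (rule mv_eqI)
    (simp add: inner_rcontr inner_involute inner_lcontr wedge_vector_right)

lemma involute_lcontr_vector:
  "involute (mv_vector v \<lrcorner> X) = - (mv_vector v \<lrcorner> involute X)"
proof (rule mv_eqI)
  fix Z
  have "involute (mv_vector v \<lrcorner> X) \<bullet> Z = X \<bullet> (mv_vector v \<^bold>\<and> involute Z)"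
    by (simp add: inner_involute inner_lcontr)
  also have "\<dots> = - (X \<bullet> involute (mv_vector v \<^bold>\<and> Z))"
    by (simp add: involute_wedge_vector)
  also have "\<dots> = - (mv_vector v \<lrcorner> involute X) \<bullet> Z"
    by (simp add: inner_lcontr flip: inner_involute)
  finally show "involute (mv_vector v \<lrcorner> X) \<bullet> Z = - (mv_vector v \<lrcorner> involute X) \<bullet> Z" .
qed

lemma lcontr_vector_axis_in:
  fixes A :: "'n::{finite,linorder} set"
  assumes "subspace R" "\<And>B. B \<subset> A \<Longrightarrow> axis B 1 \<in> R"
  shows "mv_vector v \<lrcorner> axis A 1 \<in> R"
proof -
  have "mv_vector v \<lrcorner> axis A 1 = (\<Sum>i\<in>UNIV. v $ i *\<^sub>R (axis {i} 1 \<lrcorner> axis A 1))"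
    by (simp add: mv_vector_def lcontr_linear_simps)
  also have "\<dots> \<in> R"
  proof (intro subspace_sum subspace_scale assms(1))
    fix i
    show "axis {i} 1 \<lrcorner> axis A 1 \<in> R"
      using assms(2)[of "A - {i}"]
      by (auto simp: lcontr_axis intro!: subspace_scale[OF assms(1)] subspace_0[OF assms(1)])
  qed
  finally show ?thesis .
qed

lemma involute_in_iff:
  assumes "subspace R"
  shows "involute (axis A 1) \<in> R \<longleftrightarrow> axis A 1 \<in> R"
proof (cases "even (card A)")
  case True
  then show ?thesis by (simp add: involute_axis)
next
  case False
  then have eq: "involute (axis A 1) = - axis A 1" by (simp add: involute_axis)
  have "- axis A 1 \<in> R \<longleftrightarrow> axis A 1 \<in> R"
    using subspace_neg[OF assms, of "axis A 1"] subspace_neg[OF assms, of "- axis A 1"]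
    by (metis minus_minus)
  then show ?thesis by (simp only: eq)
qed

lemma subspace_generated:
  fixes R :: "'n::{finite,linorder} mv set"
  assumes R: "subspace R" "mv_scalar 1 \<in> R"
    and step: "\<And>i A. i \<notin> A \<Longrightarrow> (\<And>B. B \<subseteq> A \<Longrightarrow> axis B 1 \<in> R) \<Longrightarrow> axis {i} 1 \<^bold>\<and> axis A 1 \<in> R"
  shows "X \<in> R"
proof -
  have "axis A 1 \<in> R" for A :: "'n set"
  proof (induction "card A" arbitrary: A rule: less_induct)
    case less
    show ?case
    proof (cases "A = {}")
      case True
      then show ?thesis using R(2) by (simp add: mv_scalar_eq)
    next
      case False
      then obtain i A' where A: "A = insert i A'" "i \<notin> A'"
        by (metis all_not_in_conv mk_disjoint_insert)
      have "axis {i} 1 \<^bold>\<and> axis A' 1 \<in> R"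
      proof (rule step[OF A(2)])
        fix B assume "B \<subseteq> A'"
        then have "B \<subset> A" using A by blast
        then show "axis B 1 \<in> R" by (intro less psubset_card_mono) simp_all
      qed
      then have "wedge_sign {i} A' *\<^sub>R (axis {i} 1 \<^bold>\<and> axis A' 1) \<in> R"
        by (rule subspace_scale[OF R(1)])
      then show ?thesis using A by (simp add: wedge_axis)
    qed
  qed
  then have "(\<Sum>A\<in>UNIV. X $ A *\<^sub>R axis A 1) \<in> R"
    by (intro subspace_sum subspace_scale R(1))
  then show ?thesis by (simp flip: mv_expand)
qed

definition cliff_left :: "('n::{finite,linorder} canon \<Rightarrow> 'n canon) \<Rightarrow> 'n canon \<Rightarrow> 'n mv \<Rightarrow> 'n mv" where
  "cliff_left m b X = mv_vector (m b) \<lrcorner> X + mv_vector b \<^bold>\<and> X"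

definition cliff_right :: "('n::{finite,linorder} canon \<Rightarrow> 'n canon) \<Rightarrow> 'n canon \<Rightarrow> 'n mv \<Rightarrow> 'n mv" where
  "cliff_right m b X = X \<llcorner> mv_vector (m b) + X \<^bold>\<and> mv_vector b"

lemma cliff_right_eq: "cliff_right m b X = involute (mv_vector (m b) \<lrcorner> X - mv_vector b \<^bold>\<and> X)"
  by (simp add: cliff_right_def rcontr_vector wedge_vector_right involute_wedge_vector
      involute_linear_simps)

lemma linear_cliff_left: "linear (cliff_left m b)"
  unfolding cliff_left_def
  by (auto intro!: linearI simp: lcontr_linear_simps wedge_linear_simps algebra_simps)

lemma linear_cliff_right: "linear (cliff_right m b)"
  unfolding cliff_right_eq
  by (auto intro!: linearI
      simp: lcontr_linear_simps wedge_linear_simps involute_linear_simps algebra_simps)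

lemma cliff_commute:
  assumes "\<And>x y. m x \<bullet> y = x \<bullet> m y"
  shows "cliff_left m b (cliff_right m c X) = cliff_right m c (cliff_left m b X)"
proof -
  have eq: "m b \<bullet> c = m c \<bullet> b" using assms by (metis inner_commute)
  have "cliff_left m b (cliff_right m c X) =
     involute (- (mv_vector (m b) \<lrcorner> (mv_vector (m c) \<lrcorner> X - mv_vector c \<^bold>\<and> X))
               - (mv_vector b \<^bold>\<and> (mv_vector (m c) \<lrcorner> X - mv_vector c \<^bold>\<and> X)))"
    unfolding cliff_left_def cliff_right_eq
    by (simp add: involute_linear_simps involute_lcontr_vector involute_wedge_vector)
  also have "- (mv_vector (m b) \<lrcorner> (mv_vector (m c) \<lrcorner> X - mv_vector c \<^bold>\<and> X))
               - (mv_vector b \<^bold>\<and> (mv_vector (m c) \<lrcorner> X - mv_vector c \<^bold>\<and> X)) =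
      mv_vector (m c) \<lrcorner> cliff_left m b X - mv_vector c \<^bold>\<and> cliff_left m b X"
    by (simp add: cliff_left_def lcontr_linear_simps wedge_linear_simps lcontr_vector_wedge eq
        lcontr_vector_anticomm[of "m b" "m c"] wedge_vector_swap[of b c])
  finally show ?thesis by (simp add: cliff_right_eq)
qed

inductive_set op_closure :: "('b \<Rightarrow> 'a::real_vector \<Rightarrow> 'a) \<Rightarrow> ('a \<Rightarrow> 'a) set" for F where
  scale: "(\<lambda>X. r *\<^sub>R X) \<in> op_closure F"
| comp: "f \<in> op_closure F \<Longrightarrow> (\<lambda>X. F b (f X)) \<in> op_closure F"
| add: "f \<in> op_closure F \<Longrightarrow> g \<in> op_closure F \<Longrightarrow> (\<lambda>X. f X + g X) \<in> op_closure F"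

lemma op_closure_linear:
  assumes "f \<in> op_closure F" "\<And>b. linear (F b)"
  shows "linear f"
  using assms(1)
  by induction
    (auto intro!: linearI simp: scaleR_right_distrib linear_add[OF assms(2)] linear_scale[OF assms(2)]
      linear_add linear_scale)

lemma op_closure_comp:
  assumes "f \<in> op_closure F" "\<And>b. linear (F b)" "g \<in> op_closure F"
  shows "(\<lambda>X. f (g X)) \<in> op_closure F"
  using assms(1)
proof induction
  case (scale r)
  show ?case using assms(3)
  proof induction
    case (scale s)
    then show ?case using op_closure.scale[of "r * s" F] by simp
  next
    case (comp f b)
    then show ?case
      using op_closure.comp[OF comp.IH, of b] by (simp add: linear_scale[OF assms(2)])
  next
    case (add f g)
    then show ?case using op_closure.add[OF add.IH] by (simp add: scaleR_right_distrib)
  qed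
qed (auto intro: op_closure.intros)

lemma op_closure_commute:
  assumes f: "f \<in> op_closure F" and g: "g \<in> op_closure G"
    and F: "\<And>b. linear (F b)" and G: "\<And>b. linear (G b)"
    and comm: "\<And>b c X. F b (G c X) = G c (F b X)"
  shows "f (g X) = g (f X)"
proof -
  have 1: "F b (g X) = g (F b X)" for b X
    using g by (induction arbitrary: X)
      (simp_all add: linear_scale[OF F] linear_add[OF F] comm)
  have lin: "linear g" using op_closure_linear[OF g G] .
  show ?thesis
    using f by (induction arbitrary: X)
      (simp_all add: linear_scale[OF lin] linear_add[OF lin] 1)
qed

lemma op_closure_surj:
  assumes "\<And>R. subspace R \<Longrightarrow> e \<in> R \<Longrightarrow> (\<And>b X. X \<in> R \<Longrightarrow> F b X \<in> R) \<Longrightarrow> Y \<in> R"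
    and "\<And>b. linear (F b)"
  shows "\<exists>f\<in>op_closure F. f e = Y"
proof -
  define S where "S = (\<lambda>f. f e) ` op_closure F"
  have SI: "X \<in> S" if "f \<in> op_closure F" "f e = X" for f X
    using that by (auto simp: S_def)
  have "Y \<in> S"
  proof (rule assms(1))
    show "subspace S"
      unfolding subspace_def
    proof (intro conjI ballI allI)
      show "0 \<in> S" by (rule SI[OF op_closure.scale[of 0]]) simp
      fix X assume "X \<in> S"
      then obtain f where f: "f \<in> op_closure F" "f e = X" by (auto simp: S_def)
      show "r *\<^sub>R X \<in> S" for r
        by (rule SI[OF op_closure_comp[OF op_closure.scale assms(2) f(1), of r]]) (simp add: f(2))
      fix X' assume "X' \<in> S"
      then obtain g where g: "g \<in> op_closure F" "g e = X'" by (auto simp: S_def)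
      show "X + X' \<in> S"
        by (rule SI[OF op_closure.add[OF f(1) g(1)]]) (simp add: f(2) g(2))
    qed
    show "e \<in> S" by (rule SI[OF op_closure.scale[of 1]]) simp
    fix b X assume "X \<in> S"
    then obtain f where f: "f \<in> op_closure F" "f e = X" by (auto simp: S_def)
    show "F b X \<in> S" by (rule SI[OF op_closure.comp[OF f(1)]]) (simp add: f(2))
  qed
  then show ?thesis by (auto simp: S_def)
qed

lemma cliff_left_generates:
  fixes R :: "'n::{finite,linorder} mv set"
  assumes "subspace R" "mv_scalar 1 \<in> R" "\<And>b X. X \<in> R \<Longrightarrow> cliff_left m b X \<in> R"
  shows "X \<in> R"
proof (rule subspace_generated[OF assms(1,2)])
  fix i :: 'n and A assume B: "\<And>B. B \<subseteq> A \<Longrightarrow> axis B 1 \<in> R"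
  then have "cliff_left m (axis i 1) (axis A 1) - mv_vector (m (axis i 1)) \<lrcorner> axis A 1 \<in> R"
    by (intro subspace_diff assms lcontr_vector_axis_in) auto
  then show "axis {i} 1 \<^bold>\<and> axis A 1 \<in> R" by (simp add: cliff_left_def)
qed

lemma cliff_right_generates:
  fixes R :: "'n::{finite,linorder} mv set"
  assumes "subspace R" "mv_scalar 1 \<in> R" "\<And>b X. X \<in> R \<Longrightarrow> cliff_right m b X \<in> R"
  shows "X \<in> R"
proof (rule subspace_generated[OF assms(1,2)])
  fix i :: 'n and A assume i: "i \<notin> A" and B: "\<And>B. B \<subseteq> A \<Longrightarrow> axis B 1 \<in> R"
  let ?v = "mv_vector (m (axis i 1))"
  have "?v \<lrcorner> involute (axis A 1) \<in> R"
    unfolding involute_axis lcontr_linear_simps using B assms(1)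
    by (intro subspace_scale lcontr_vector_axis_in) auto
  then have "involute (?v \<lrcorner> axis A 1) \<in> R"
    by (simp add: involute_lcontr_vector subspace_neg[OF assms(1)])
  moreover have "cliff_right m (axis i 1) (axis A 1) \<in> R"
    using B by (intro assms(3)) simp
  ultimately have "involute (?v \<lrcorner> axis A 1) - cliff_right m (axis i 1) (axis A 1) \<in> R"
    by (rule subspace_diff[OF assms(1)])
  then have "wedge_sign {i} A *\<^sub>R involute (axis (insert i A) 1) \<in> R"
    using i by (simp add: cliff_right_eq involute_linear_simps wedge_axis)
  then have "wedge_sign {i} A *\<^sub>R wedge_sign {i} A *\<^sub>R involute (axis (insert i A) 1) \<in> R"
    by (rule subspace_scale[OF assms(1)])
  then have "axis (insert i A) 1 \<in> R"
    by (simp add: involute_in_iff[OF assms(1)])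
  then show "axis {i} 1 \<^bold>\<and> axis A 1 \<in> R"
    using i by (simp add: wedge_axis subspace_scale[OF assms(1)])
qed

lemma cliff_one: "cliff_left m b (mv_scalar 1) = mv_vector b" "cliff_right m b (mv_scalar 1) = mv_vector b"
  by (simp_all add: cliff_left_def cliff_right_def rcontr_vector lcontr_vector_scalar wedge_scalar
      involute_linear_simps)

lemma is_clifford_product_iff:
  assumes "linear m"
  shows "is_clifford_product m P \<longleftrightarrow>
     bilinear P \<and> (\<forall>X Y Z. P (P X Y) Z = P X (P Y Z)) \<and>
     (\<forall>r X. P (mv_scalar r) X = r *\<^sub>R X \<and> P X (mv_scalar r) = r *\<^sub>R X) \<and>
     (\<forall>b X. P (mv_vector b) X = cliff_left m b X \<and> P X (mv_vector b) = cliff_right m b X)"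
  unfolding is_clifford_product_def metric_lcontr_def metric_rcontr_def cliff_left_def
    cliff_right_def outermorphism_vector[OF assms] ..

lemma ex1_clifford_product:
  fixes m :: "'n::{finite,linorder} canon \<Rightarrow> 'n canon"
  assumes lin: "linear m" and adj: "adjoint m = m"
  shows "\<exists>!P. is_clifford_product m P"
proof -
  have sym: "m x \<bullet> y = x \<bullet> m y" for x y
    using adjoint_clauses(1)[OF lin, of x y] adj by simp
  note L = linear_cliff_left[of m] and R = linear_cliff_right[of m]
  let ?L = "op_closure (cliff_left m)" and ?R = "op_closure (cliff_right m)"
  define one where "one = (mv_scalar 1 :: 'n mv)"
  have exL: "\<exists>f\<in>?L. f one = X" for X
    using cliff_left_generates unfolding one_def by (intro op_closure_surj L) blast
  have exR: "\<exists>f\<in>?R. f one = X" for X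
    using cliff_right_generates unfolding one_def by (intro op_closure_surj R) blast
  have comm: "f (h X) = h (f X)" if "f \<in> ?L" "h \<in> ?R" for f h X
    by (rule op_closure_commute[OF that L R cliff_commute[OF sym]])
  have uniq: "f = g" if "f \<in> ?L" "g \<in> ?L" "f one = g one" for f g
  proof
    fix X
    obtain h where h: "h \<in> ?R" "h one = X" using exR by blast
    have "f (h one) = h (f one)" "g (h one) = h (g one)"
      using that(1,2) h(1) by (auto intro: comm)
    with that(3) h(2) show "f X = g X" by simp
  qed
  define P where "P = (\<lambda>X. SOME f. f \<in> ?L \<and> f one = X)"
  have P: "P X \<in> ?L" "P X one = X" for X
    using someI_ex[of "\<lambda>f. f \<in> ?L \<and> f one = X"] exL[of X] by (auto simp: P_def)
  have P_eq: "P X Y = f Y" if "f \<in> ?L" "f one = X" for f X Y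
    using uniq[OF P(1) that(1)] P(2) that(2) by simp
  have linP: "linear (P X)" for X by (rule op_closure_linear[OF P(1) L])
  have scal: "mv_scalar r = r *\<^sub>R one" for r by (simp add: one_def mv_scalar_eq)
  have "is_clifford_product m P"
    unfolding is_clifford_product_iff[OF lin]
  proof (intro conjI allI)
    show "bilinear P"
      unfolding bilinear_def
    proof (intro conjI allI linP linearI)
      show "P (X + X') Y = P X Y + P X' Y" for X X' Y
        by (rule P_eq[OF op_closure.add[OF P(1) P(1)]]) (simp add: P(2))
      show "P (r *\<^sub>R X) Y = r *\<^sub>R P X Y" for r X Y
        by (rule P_eq[OF op_closure_comp[OF op_closure.scale L P(1)]]) (simp add: P(2))
    qed
    show "P (P X Y) Z = P X (P Y Z)" for X Y Z
      by (rule P_eq[OF op_closure_comp[OF P(1) L P(1)]]) (simp add: P(2))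
    show "P (mv_scalar r) X = r *\<^sub>R X" for r X
      by (rule P_eq[OF op_closure.scale]) (simp add: scal)
    show "P X (mv_scalar r) = r *\<^sub>R X" for r X
      by (simp add: scal linear_scale[OF linP] P(2))
    show "P (mv_vector b) X = cliff_left m b X" for b X
      using P_eq[OF op_closure.comp[OF op_closure.scale[of 1]], of b "mv_vector b" X]
      by (simp add: one_def cliff_one)
    show "P X (mv_vector b) = cliff_right m b X" for b X
    proof -
      have "(\<lambda>X. cliff_right m b X) \<in> ?R"
        using op_closure.comp[OF op_closure.scale[of 1 "cliff_right m"], of b] by simp
      then have "P X (cliff_right m b one) = cliff_right m b (P X one)"
        by (rule comm[OF P(1)])
      then show ?thesis using cliff_one(2)[of m b] by (simp add: P(2) flip: one_def)
    qed
  qed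
  moreover have "P1 = P2" if P1: "is_clifford_product m P1" and P2: "is_clifford_product m P2" for P1 P2
  proof (intro ext)
    fix X Y
    note P1 = P1[unfolded is_clifford_product_iff[OF lin]] and P2 = P2[unfolded is_clifford_product_iff[OF lin]]
    have bil: "bilinear P1" "bilinear P2" using P1 P2 by auto
    have "X \<in> {X. \<forall>Y. P1 X Y = P2 X Y}"
    proof (rule cliff_left_generates[where m = m])
      show "subspace {X. \<forall>Y. P1 X Y = P2 X Y}"
        by (auto simp: subspace_def bilinear_lzero[OF bil(1)] bilinear_lzero[OF bil(2)]
            bilinear_ladd[OF bil(1)] bilinear_ladd[OF bil(2)]
            bilinear_lmul[OF bil(1)] bilinear_lmul[OF bil(2)])
      show "mv_scalar 1 \<in> {X. \<forall>Y. P1 X Y = P2 X Y}" using P1 P2 by simp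
      fix b X assume X: "X \<in> {X. \<forall>Y. P1 X Y = P2 X Y}"
      have "P1 (cliff_left m b X) Y = P2 (cliff_left m b X) Y" for Y
      proof -
        have "P1 (cliff_left m b X) Y = cliff_left m b (P1 X Y)" using P1 by metis
        moreover have "P2 (cliff_left m b X) Y = cliff_left m b (P2 X Y)" using P2 by metis
        ultimately show ?thesis using X by simp
      qed
      then show "cliff_left m b X \<in> {X. \<forall>Y. P1 X Y = P2 X Y}" by simp
    qed
    then show "P1 X Y = P2 X Y" by simp
  qed
  ultimately show ?thesis by blast
qed

lemma is_clifford_product_clifford:
  assumes "linear m" and "adjoint m = m"
  shows "is_clifford_product m (clifford m)"
  unfolding clifford_def by (rule theI'[OF ex1_clifford_product[OF assms]])

end

(* Along a coordinate line through p both operators have the form d/ds + (the derivation of the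
   exterior algebra induced by an endomorphism t), with t = gamma for the plus operator and
   t = - gamma^dagger for the minus operator; compatibility says that the metric m along the line
   (g, respectively its inverse) satisfies m' = t^dagger m + m t.  Such derivations obey the Leibniz
   rule for the exterior product, their Euclidean adjoints are the derivations of the adjoint
   endomorphisms, and m' = t^dagger m + m t passes from vectors to the exterior extension of m; this
   gives the rules for the scalar product and the contractions.  For the Clifford product the left
   factor is built up blade by blade from b (A Y) = (b A) Y and b A = m(b) _| A + b ^ A. *)

theory Submission
  imports Defs
begin

subsection \<open>Derivations of the exterior algebra\<close>

text \<open>For linear \<open>t\<close> this is the derivation of the exterior algebra that extends
  \<open>t\<close>: each summand removes a factor in the direction of a basis vector and puts its
  image under \<open>t\<close> in its place. It is the formula of \<open>Gam\<close> with the
  endomorphism as a free parameter, so that the minus operator is covered by inserting the negative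
  of the adjoint.\<close>

definition derivation_ext :: "('n canon \<Rightarrow> 'n canon) \<Rightarrow> 'n::{finite,linorder} mv \<Rightarrow> 'n mv" where
  "derivation_ext t X = (\<Sum>\<mu>\<in>UNIV. mv_vector (t (axis \<mu> 1)) \<^bold>\<and> (mv_vector (axis \<mu> 1) \<lrcorner> X))"

lemma linear_derivation_ext: "linear (derivation_ext t)"
  unfolding derivation_ext_def
  by (auto intro!: linearI simp: wedge_linear_simps lcontr_linear_simps sum.distrib scaleR_sum_right
      simp del: mv_vector_axis)

lemmas derivation_ext_linear_simps =
  linear_add[OF linear_derivation_ext] linear_scale[OF linear_derivation_ext]
  linear_neg[OF linear_derivation_ext] linear_diff[OF linear_derivation_ext]
  linear_0[OF linear_derivation_ext] linear_sum[OF linear_derivation_ext]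

lemma sum_axis_expand:
  fixes v :: "'n::finite canon"
  shows "(\<Sum>\<mu>\<in>UNIV. (axis \<mu> 1 \<bullet> v) *\<^sub>R axis \<mu> 1) = v"
proof -
  have "axis \<mu> 1 \<bullet> v = v $ \<mu>" for \<mu> by (simp add: inner_axis')
  then show ?thesis by (simp add: vec_eq_iff axis_def if_distrib cong: if_cong)
qed

lemma linear_axis_expand:
  fixes v :: "'n::finite canon"
  assumes "linear t"
  shows "t v = (\<Sum>\<mu>\<in>UNIV. (axis \<mu> 1 \<bullet> v) *\<^sub>R t (axis \<mu> 1))"
proof -
  have "t v = t (\<Sum>\<mu>\<in>UNIV. (axis \<mu> 1 \<bullet> v) *\<^sub>R axis \<mu> 1)"
    by (simp only: sum_axis_expand)
  then show ?thesis by (simp only: linear_sum[OF assms] linear_scale[OF assms])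
qed

text \<open>Contraction with a basis vector is an antiderivation. Its scalar terms add up to
  \<open>t v\<close> by linearity, and the minus sign of the other terms is absorbed when
  \<open>mv_vector v\<close> is moved past \<open>mv_vector (t (axis \<mu> 1))\<close>.\<close>

lemma derivation_ext_wedge_vector:
  assumes "linear t"
  shows "derivation_ext t (mv_vector v \<^bold>\<and> X) = mv_vector (t v) \<^bold>\<and> X + mv_vector v \<^bold>\<and> derivation_ext t X"
proof -
  have "derivation_ext t (mv_vector v \<^bold>\<and> X) =
      (\<Sum>\<mu>\<in>UNIV. (axis \<mu> 1 \<bullet> v) *\<^sub>R (mv_vector (t (axis \<mu> 1)) \<^bold>\<and> X) +
        mv_vector v \<^bold>\<and> (mv_vector (t (axis \<mu> 1)) \<^bold>\<and> (mv_vector (axis \<mu> 1) \<lrcorner> X)))"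
    unfolding derivation_ext_def
    by (simp add: lcontr_vector_wedge wedge_linear_simps wedge_vector_swap[of v] del: mv_vector_axis)
  also have "\<dots> = mv_vector (\<Sum>\<mu>\<in>UNIV. (axis \<mu> 1 \<bullet> v) *\<^sub>R t (axis \<mu> 1)) \<^bold>\<and> X +
      mv_vector v \<^bold>\<and> derivation_ext t X"
    by (simp add: derivation_ext_def sum.distrib wedge_linear_simps mv_vector_linear_simps
        linear_sum[OF linear_mv_vector] del: mv_vector_axis)
  finally show ?thesis by (simp only: linear_axis_expand[OF assms, of v, symmetric])
qed

lemma derivation_ext_scalar: "derivation_ext t (mv_scalar r) = 0"
  by (simp add: derivation_ext_def lcontr_vector_scalar wedge_linear_simps del: mv_vector_axis)

lemma derivation_ext_vector:
  assumes "linear t"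
  shows "derivation_ext t (mv_vector v) = mv_vector (t v)"
  using derivation_ext_wedge_vector[OF assms, of v "mv_scalar 1"]
  by (simp add: wedge_scalar derivation_ext_scalar wedge_linear_simps)

text \<open>Every basis blade arises, up to sign, from \<open>mv_scalar 1\<close> by wedging vectors
  on the left, and the basis blades span. Identities that are linear in \<open>X\<close> can
  therefore be proved one leading vector at a time.\<close>

lemma mv_induct [consumes 0, case_names subspace one wedge]:
  fixes X :: "'n::{finite,linorder} mv"
  assumes "subspace {X. Q X}" "Q (mv_scalar 1)" "\<And>v X. Q X \<Longrightarrow> Q (mv_vector v \<^bold>\<and> X)"
  shows "Q X"
proof -
  have "X \<in> {X. Q X}"
  proof (rule subspace_generated[OF assms(1)])
    show "mv_scalar 1 \<in> {X. Q X}" using assms(2) by simp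
    show "axis {i} 1 \<^bold>\<and> axis A 1 \<in> {X. Q X}" if "\<And>B. B \<subseteq> A \<Longrightarrow> axis B 1 \<in> {X. Q X}"
      for i :: 'n and A
      using that[of A] assms(3)[of _ "axis i 1"] by simp
  qed
  then show ?thesis by simp
qed

text \<open>Induction on the left factor: associativity brings its leading vector to the front of
  the whole product, where the rule for one vector applies.\<close>

lemma derivation_ext_wedge:
  assumes "linear t"
  shows "derivation_ext t (X \<^bold>\<and> Y) = derivation_ext t X \<^bold>\<and> Y + X \<^bold>\<and> derivation_ext t Y"
proof (induction X rule: mv_induct)
  case subspace
  show ?case
    by (auto simp: subspace_def wedge_linear_simps derivation_ext_linear_simps algebra_simps)
next
  case one
  show ?case by (simp add: wedge_scalar derivation_ext_scalar wedge_linear_simps)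
next
  case (wedge v X)
  then show ?case
    by (simp add: derivation_ext_wedge_vector[OF assms] wedge_assoc wedge_linear_simps)
qed

text \<open>On a basis blade reversion reverses the list of factors, so the leading vector moves to
  the end; linearity does the rest.\<close>

lemma reversion_wedge_vector:
  fixes X :: "'n::{finite,linorder} mv"
  shows "reversion (mv_vector v \<^bold>\<and> X) = reversion X \<^bold>\<and> mv_vector v"
proof (rule linear_eq_axis[where X = X])
  show "reversion (mv_vector v \<^bold>\<and> axis A 1) = reversion (axis A 1) \<^bold>\<and> mv_vector v" for A
    using reversion_blade[of "v # map (\<lambda>\<mu>. axis \<mu> 1) (sorted_list_of_set A)"]
      reversion_blade[of "map (\<lambda>\<mu>. axis \<mu> 1) (sorted_list_of_set A)"]
    by (simp add: blade_basis blade_append wedge_scalar)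
qed (auto intro!: linearI simp: wedge_linear_simps linear_add[OF linear_reversion]
    linear_scale[OF linear_reversion])

lemma derivation_ext_reversion:
  assumes "linear t"
  shows "derivation_ext t (reversion X) = reversion (derivation_ext t X)"
proof (induction X rule: mv_induct)
  case subspace
  show ?case
    by (auto simp: subspace_def derivation_ext_linear_simps linear_add[OF linear_reversion]
        linear_scale[OF linear_reversion] linear_0[OF linear_reversion])
next
  case one
  have "reversion (mv_scalar 1) = (mv_scalar 1 :: 'a mv)"
    by (simp add: mv_scalar_def reversion_axis)
  then show ?case by (simp add: derivation_ext_scalar linear_0[OF linear_reversion])
next
  case (wedge v X)
  then show ?case
    by (simp add: derivation_ext_wedge_vector[OF assms] reversion_wedge_vector
        derivation_ext_wedge[OF assms] derivation_ext_vector[OF assms] linear_add[OF linear_reversion])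
qed

text \<open>Wedging with a vector and contracting with it are Euclidean adjoints. Taking adjoints in
  each summand thus exchanges the roles of \<open>axis \<mu> 1\<close> and
  \<open>t (axis \<mu> 1)\<close>; expanding the latter in the basis and swapping the two sums moves
  the matrix of \<open>t\<close> to its transpose.\<close>

lemma inner_derivation_ext:
  assumes "linear t"
  shows "derivation_ext t X \<bullet> Y = X \<bullet> derivation_ext (adjoint t) Y"
proof -
  have exp: "mv_vector w = (\<Sum>\<nu>\<in>UNIV. (axis \<nu> 1 \<bullet> w) *\<^sub>R mv_vector (axis \<nu> 1))" for w :: "'a canon"
    by (rule linear_axis_expand[OF linear_mv_vector])
  have "(\<Sum>\<mu>\<in>UNIV. mv_vector (axis \<mu> 1) \<^bold>\<and> (mv_vector (t (axis \<mu> 1)) \<lrcorner> Y)) =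
      (\<Sum>\<mu>\<in>UNIV. \<Sum>\<nu>\<in>UNIV. (axis \<nu> 1 \<bullet> t (axis \<mu> 1)) *\<^sub>R
        (mv_vector (axis \<mu> 1) \<^bold>\<and> (mv_vector (axis \<nu> 1) \<lrcorner> Y)))" (is "?l = _")
    by (simp only: exp[of "t _"] lcontr_linear_simps wedge_linear_simps)
  also have "\<dots> = (\<Sum>\<nu>\<in>UNIV. \<Sum>\<mu>\<in>UNIV. (axis \<mu> 1 \<bullet> adjoint t (axis \<nu> 1)) *\<^sub>R
        (mv_vector (axis \<mu> 1) \<^bold>\<and> (mv_vector (axis \<nu> 1) \<lrcorner> Y)))"
    by (subst sum.swap) (simp add: adjoint_clauses[OF assms] inner_commute del: mv_vector_axis)
  also have "\<dots> = derivation_ext (adjoint t) Y"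
    unfolding derivation_ext_def
    by (simp only: exp[of "adjoint t _"] wedge_linear_simps)
  finally have "?l = derivation_ext (adjoint t) Y" .
  moreover have "derivation_ext t X \<bullet> Y = X \<bullet> ?l"
  proof -
    have "(mv_vector v \<^bold>\<and> (mv_vector w \<lrcorner> X)) \<bullet> Y = X \<bullet> (mv_vector w \<^bold>\<and> (mv_vector v \<lrcorner> Y))" for v w
      using inner_lcontr[of "mv_vector v" Y "mv_vector w \<lrcorner> X"]
        inner_lcontr[of "mv_vector w" X "mv_vector v \<lrcorner> Y"]
      by (simp add: inner_commute)
    then show ?thesis
      by (simp add: derivation_ext_def inner_sum_left inner_sum_right del: mv_vector_axis)
  qed
  ultimately show ?thesis by simp
qed

lemma adjoint_derivation_ext:
  assumes "linear t"
  shows "adjoint (derivation_ext t) = derivation_ext (adjoint t)"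
  by (rule adjoint_unique) (simp add: inner_derivation_ext[OF assms])

text \<open>Dual to the product rule for the exterior product with \<open>adjoint t\<close>. The
  left factor is differentiated by the adjoint with the opposite sign; this defect is what the
  derivative of the metric on the left factor later compensates.\<close>

lemma derivation_ext_lcontr:
  assumes "linear t"
  shows "derivation_ext t (X \<lrcorner> Y) = X \<lrcorner> derivation_ext t Y - derivation_ext (adjoint t) X \<lrcorner> Y"
proof (rule mv_eqI)
  fix Z
  have adj: "linear (adjoint t)" by (rule adjoint_linear[OF assms])
  show "derivation_ext t (X \<lrcorner> Y) \<bullet> Z =
      (X \<lrcorner> derivation_ext t Y - derivation_ext (adjoint t) X \<lrcorner> Y) \<bullet> Z"
    by (simp add: inner_diff_left inner_lcontr inner_derivation_ext[OF assms] inner_diff_right inner_add_right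
        derivation_ext_wedge[OF adj] derivation_ext_reversion[OF adj])
qed

lemma derivation_ext_rcontr:
  assumes "linear t"
  shows "derivation_ext t (X \<llcorner> Y) = derivation_ext t X \<llcorner> Y - X \<llcorner> derivation_ext (adjoint t) Y"
proof (rule mv_eqI)
  fix Z
  have adj: "linear (adjoint t)" by (rule adjoint_linear[OF assms])
  show "derivation_ext t (X \<llcorner> Y) \<bullet> Z =
      (derivation_ext t X \<llcorner> Y - X \<llcorner> derivation_ext (adjoint t) Y) \<bullet> Z"
    by (simp add: inner_diff_left inner_rcontr inner_derivation_ext[OF assms] inner_diff_right inner_add_right
        derivation_ext_wedge[OF adj] derivation_ext_reversion[OF adj])
qed

subsection \<open>Leibniz rules along a curve\<close>

text \<open>The metric is required to be linear and symmetric only near \<open>0\<close>, because on a manifold the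
  metric field is arbitrary outside \<open>U\<close>.\<close>

locale compatible_curve =
  fixes m :: "real \<Rightarrow> 'n::{finite,linorder} canon \<Rightarrow> 'n canon" and t :: "'n canon \<Rightarrow> 'n canon"
  assumes linear_t: "linear t"
    and metric: "\<forall>\<^sub>F s in nhds 0. linear (m s) \<and> adjoint (m s) = m s"
    and compatible: "((\<lambda>s. m s v) has_vector_derivative (adjoint t (m 0 v) + m 0 (t v))) (at 0)"
begin

section \<open>Elementary calculus of covariant derivatives along the curve\<close>

lemma metric_0: "linear (m 0)" "adjoint (m 0) = m 0"
  using eventually_nhds_x_imp_x[OF metric] by auto

text \<open>\<open>D\<close> is the value at \<open>0\<close> of the operator d/ds +
  \<open>derivation_ext t\<close> on \<open>X\<close>. As a relation it includes the
  differentiability of \<open>X\<close> at \<open>0\<close>, so each product rule below also yields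
  differentiability of the product.\<close>

definition has_cov :: "(real \<Rightarrow> 'n mv) \<Rightarrow> 'n mv \<Rightarrow> bool" where
  "has_cov X D \<longleftrightarrow> (X has_vector_derivative (D - derivation_ext t (X 0))) (at 0)"

lemma has_cov_unique: "has_cov X D \<Longrightarrow> has_cov X E \<Longrightarrow> D = E"
  unfolding has_cov_def by (auto dest: vector_derivative_unique_at)

text \<open>Used to replace a curve by an expression that agrees with it only where the metric is
  linear and symmetric, that is, near \<open>0\<close>. Agreement near \<open>0\<close> includes
  \<open>0\<close> itself, hence the connection terms coincide as well.\<close>

lemma has_cov_cong:
  assumes "has_cov X D" "\<forall>\<^sub>F s in nhds 0. X s = Y s"
  shows "has_cov Y D"
proof -
  have eq: "X 0 = Y 0" using eventually_nhds_x_imp_x[OF assms(2)] .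
  then have "(X has_vector_derivative D') (at 0) = (Y has_vector_derivative D') (at 0)" for D'
    by (intro has_vector_derivative_cong_ev) (use assms(2) eq in simp_all)
  with assms(1) show ?thesis by (simp only: has_cov_def eq)
qed

lemma has_cov_const: "has_cov (\<lambda>s. X) (derivation_ext t X)"
  by (simp add: has_cov_def)

lemma has_cov_add: "has_cov X D \<Longrightarrow> has_cov Y E \<Longrightarrow> has_cov (\<lambda>s. X s + Y s) (D + E)"
  unfolding has_cov_def
  by (drule (1) has_vector_derivative_add) (simp add: derivation_ext_linear_simps algebra_simps)

lemma has_cov_diff: "has_cov X D \<Longrightarrow> has_cov Y E \<Longrightarrow> has_cov (\<lambda>s. X s - Y s) (D - E)"
  unfolding has_cov_def
  by (drule (1) has_vector_derivative_diff) (simp add: derivation_ext_linear_simps algebra_simps)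

lemma has_cov_sum:
  "(\<And>i. i \<in> I \<Longrightarrow> has_cov (X i) (D i)) \<Longrightarrow> has_cov (\<lambda>s. \<Sum>i\<in>I. X i s) (\<Sum>i\<in>I. D i)"
  unfolding has_cov_def derivation_ext_linear_simps sum_subtractf[symmetric]
  by (rule has_vector_derivative_sum)

lemma has_cov_scaleR:
  assumes "(f has_vector_derivative f') (at 0)" "has_cov X D"
  shows "has_cov (\<lambda>s. f s *\<^sub>R X s) (f' *\<^sub>R X 0 + f 0 *\<^sub>R D)"
  using bounded_bilinear.has_vector_derivative[OF bounded_bilinear_scaleR assms(1)
      assms(2)[unfolded has_cov_def]]
  by (simp add: has_cov_def derivation_ext_linear_simps algebra_simps)

section \<open>Leibniz rules for the suitable products\<close>

lemma has_cov_wedge: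
  assumes "has_cov X D" "has_cov Y E"
  shows "has_cov (\<lambda>s. X s \<^bold>\<and> Y s) (D \<^bold>\<and> Y 0 + X 0 \<^bold>\<and> E)"
  using bounded_bilinear.has_vector_derivative[OF bilinear_conv_bounded_bilinear[THEN iffD1, OF bilinear_wedge]
      assms[unfolded has_cov_def]]
  by (simp add: has_cov_def derivation_ext_wedge[OF linear_t] wedge_linear_simps algebra_simps)

text \<open>Induction over the factors. The derivation of \<open>adjoint t\<close> acts on the image
  blade, that of \<open>t\<close> on the source blade; both obey the product rule and the extension
  of \<open>m 0\<close> respects the exterior product, so the equation for one vector carries over
  to blades.\<close>

lemma has_vector_derivative_outermorphism_blade:
  "((\<lambda>s. blade (map (\<lambda>\<mu>. m s (v \<mu>)) xs)) has_vector_derivative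
     (derivation_ext (adjoint t) (blade (map (\<lambda>\<mu>. m 0 (v \<mu>)) xs)) +
      outermorphism (m 0) (derivation_ext t (blade (map v xs))))) (at 0)"
proof (induction xs)
  case Nil
  then show ?case by (simp add: derivation_ext_scalar linear_0[OF linear_outermorphism])
next
  case (Cons x xs)
  have adj: "linear (adjoint t)" by (rule adjoint_linear[OF linear_t])
  have "((\<lambda>s. mv_vector (m s (v x))) has_vector_derivative
      mv_vector (adjoint t (m 0 (v x)) + m 0 (t (v x)))) (at 0)"
    by (rule bounded_linear.has_vector_derivative[OF _ compatible])
      (simp add: linear_mv_vector linear_conv_bounded_linear[symmetric])
  from bounded_bilinear.has_vector_derivative[OF bilinear_conv_bounded_bilinear[THEN iffD1, OF bilinear_wedge]
      this Cons.IH]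
  show ?case
    by (simp add: derivation_ext_wedge_vector[OF adj] derivation_ext_wedge_vector[OF linear_t]
        wedge_linear_simps linear_add[OF linear_outermorphism] mv_vector_linear_simps
        outermorphism_wedge_vector[OF metric_0(1)] outermorphism_blade[OF metric_0(1)] o_def
        algebra_simps)
qed

text \<open>Expansion in basis blades separates the motion of the coefficients of \<open>X\<close>
  from that of the metric. The term with \<open>derivation_ext t\<close> inside the extended metric
  cancels against the connection term hidden in \<open>has_cov X D\<close>.\<close>

lemma has_vector_derivative_outermorphism:
  assumes "has_cov X D"
  shows "((\<lambda>s. outermorphism (m s) (X s)) has_vector_derivative
     (derivation_ext (adjoint t) (outermorphism (m 0) (X 0)) + outermorphism (m 0) D)) (at 0)"
proof -
  let ?M = "outermorphism (m 0)" and ?D' = "derivation_ext (adjoint t)"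
  have *: "((\<lambda>s. outermorphism (m s) (axis A 1)) has_vector_derivative
     (?D' (?M (axis A 1)) + ?M (derivation_ext t (axis A 1)))) (at 0)" for A
    using has_vector_derivative_outermorphism_blade[of "\<lambda>\<mu>. axis \<mu> 1" "sorted_list_of_set A"]
    by (simp add: outermorphism_axis[symmetric] blade_basis)
  have X: "((\<lambda>s. X s $ A) has_vector_derivative (D - derivation_ext t (X 0)) $ A) (at 0)" for A
    by (rule bounded_linear.has_vector_derivative[OF bounded_linear_vec_nth assms[unfolded has_cov_def]])
  have exp: "f Z = (\<Sum>A\<in>UNIV. Z $ A *\<^sub>R f (axis A 1))" if "linear f" for f :: "'n mv \<Rightarrow> 'n mv" and Z
    by (subst mv_expand[of Z]) (simp add: linear_sum[OF that] linear_scale[OF that])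
  have "((\<lambda>s. \<Sum>A\<in>UNIV. X s $ A *\<^sub>R outermorphism (m s) (axis A 1)) has_vector_derivative
     (\<Sum>A\<in>UNIV. X 0 $ A *\<^sub>R (?D' (?M (axis A 1)) + ?M (derivation_ext t (axis A 1))) +
        (D - derivation_ext t (X 0)) $ A *\<^sub>R ?M (axis A 1))) (at 0)"
    by (intro has_vector_derivative_sum
        bounded_bilinear.has_vector_derivative[OF bounded_bilinear_scaleR X *])
  also have "(\<lambda>s. \<Sum>A\<in>UNIV. X s $ A *\<^sub>R outermorphism (m s) (axis A 1)) = (\<lambda>s. outermorphism (m s) (X s))"
    by (rule ext) (rule exp[OF linear_outermorphism, symmetric])
  also have "(\<Sum>A\<in>UNIV. X 0 $ A *\<^sub>R (?D' (?M (axis A 1)) + ?M (derivation_ext t (axis A 1))) +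
        (D - derivation_ext t (X 0)) $ A *\<^sub>R ?M (axis A 1)) =
      ?D' (?M (X 0)) + ?M (derivation_ext t (X 0)) + ?M (D - derivation_ext t (X 0))"
  proof -
    have "linear (\<lambda>Z. ?D' (?M Z))" "linear (\<lambda>Z. ?M (derivation_ext t Z))"
      using linear_compose[OF linear_outermorphism linear_derivation_ext]
        linear_compose[OF linear_derivation_ext linear_outermorphism] by (auto simp: o_def)
    from exp[OF this(1), of "X 0"] exp[OF this(2), of "X 0"]
      exp[OF linear_outermorphism, of "m 0" "D - derivation_ext t (X 0)"]
    show ?thesis by (simp add: sum.distrib scaleR_add_right)
  qed
  finally show ?thesis by (simp add: linear_diff[OF linear_outermorphism])
qed

text \<open>The derivation of \<open>adjoint t\<close> on the left factor and that of
  \<open>t\<close> on the right factor cancel in the inner product. The result has grade 0, where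
  the derivation vanishes.\<close>

lemma has_cov_metric_scalar:
  assumes "has_cov X D" "has_cov Y E"
  shows "has_cov (\<lambda>s. mv_scalar (metric_scalar (m s) (X s) (Y s)))
     (mv_scalar (metric_scalar (m 0) D (Y 0)) + mv_scalar (metric_scalar (m 0) (X 0) E))"
proof -
  have deriv: "((\<lambda>s. mv_scalar (metric_scalar (m s) (X s) (Y s)) :: 'n mv) has_vector_derivative
      mv_scalar (outermorphism (m 0) (X 0) \<bullet> (E - derivation_ext t (Y 0)) +
        (derivation_ext (adjoint t) (outermorphism (m 0) (X 0)) + outermorphism (m 0) D) \<bullet> Y 0)) (at 0)"
    unfolding metric_scalar_def mv_scalar_eq
    by (rule bounded_linear.has_vector_derivative[OF bounded_linear_scaleR_left])
      (rule bounded_bilinear.has_vector_derivative[OF bounded_bilinear_inner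
        has_vector_derivative_outermorphism[OF assms(1)] assms(2)[unfolded has_cov_def]])
  have adj: "derivation_ext (adjoint t) Z \<bullet> Y 0 = Z \<bullet> derivation_ext t (Y 0)" for Z
    using inner_derivation_ext[OF linear_t, of "Y 0" Z] by (simp add: inner_commute)
  have scalar: "mv_scalar (r + r') = (mv_scalar r + mv_scalar r' :: 'n mv)" for r r'
    by (simp add: mv_scalar_eq scaleR_add_left)
  have "outermorphism (m 0) (X 0) \<bullet> (E - derivation_ext t (Y 0)) +
        (derivation_ext (adjoint t) (outermorphism (m 0) (X 0)) + outermorphism (m 0) D) \<bullet> Y 0 =
      metric_scalar (m 0) D (Y 0) + metric_scalar (m 0) (X 0) E"
    by (simp add: metric_scalar_def inner_diff_right inner_add_left adj)
  with deriv show ?thesis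
    by (simp only: has_cov_def derivation_ext_scalar diff_zero scalar)
qed

lemma has_cov_metric_lcontr:
  assumes "has_cov X D" "has_cov Y E"
  shows "has_cov (\<lambda>s. metric_lcontr (m s) (X s) (Y s))
     (metric_lcontr (m 0) D (Y 0) + metric_lcontr (m 0) (X 0) E)"
  using bounded_bilinear.has_vector_derivative[OF bilinear_conv_bounded_bilinear[THEN iffD1, OF bilinear_lcontr]
      has_vector_derivative_outermorphism[OF assms(1)] assms(2)[unfolded has_cov_def]]
  by (simp add: has_cov_def metric_lcontr_def derivation_ext_lcontr[OF linear_t] lcontr_linear_simps
      algebra_simps)

lemma has_cov_metric_rcontr:
  assumes "has_cov X D" "has_cov Y E"
  shows "has_cov (\<lambda>s. metric_rcontr (m s) (X s) (Y s))
     (metric_rcontr (m 0) D (Y 0) + metric_rcontr (m 0) (X 0) E)"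
  using bounded_bilinear.has_vector_derivative[OF bilinear_conv_bounded_bilinear[THEN iffD1, OF bilinear_rcontr]
      assms(1)[unfolded has_cov_def] has_vector_derivative_outermorphism[OF assms(2)]]
  by (simp add: has_cov_def metric_rcontr_def derivation_ext_rcontr[OF linear_t]
      bilinear_ladd[OF bilinear_rcontr] bilinear_radd[OF bilinear_rcontr]
      bilinear_lsub[OF bilinear_rcontr] bilinear_rsub[OF bilinear_rcontr] algebra_simps)

text \<open>Reduces the Clifford rule to left factors that are basis blades from \<open>S\<close>.
  The set \<open>S\<close> allows the use inside an induction on the grade, where only small blades
  are available; the support condition is local because the metric is controlled only near
  \<open>0\<close>.\<close>

lemma has_cov_clifford_combination:
  assumes basis: "\<And>B Y E. B \<in> S \<Longrightarrow> has_cov Y E \<Longrightarrow>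
      has_cov (\<lambda>s. clifford (m s) (axis B 1) (Y s))
        (clifford (m 0) (derivation_ext t (axis B 1)) (Y 0) + clifford (m 0) (axis B 1) E)"
    and support: "\<forall>\<^sub>F s in nhds 0. \<forall>B. B \<notin> S \<longrightarrow> X s $ B = 0"
    and X: "has_cov X D" and Y: "has_cov Y E"
  shows "has_cov (\<lambda>s. clifford (m s) (X s) (Y s)) (clifford (m 0) D (Y 0) + clifford (m 0) (X 0) E)"
proof -
  define X' where "X' = D - derivation_ext t (X 0)"
  have comp: "((\<lambda>s. X s $ B) has_vector_derivative X' $ B) (at 0)" for B
    unfolding X'_def
    by (rule bounded_linear.has_vector_derivative[OF bounded_linear_vec_nth X[unfolded has_cov_def]])
  have X_eq: "Z = (\<Sum>B\<in>S. Z $ B *\<^sub>R axis B 1)" if "\<forall>B. B \<notin> S \<longrightarrow> Z $ B = 0" for Z :: "'n mv"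
  proof -
    have "(\<Sum>B\<in>S. Z $ B *\<^sub>R axis B 1) = (\<Sum>B\<in>UNIV. Z $ B *\<^sub>R axis B (1::real))"
      using that by (intro sum.mono_neutral_left) auto
    then show ?thesis by (simp flip: mv_expand)
  qed
  have "has_cov (\<lambda>s. \<Sum>B\<in>S. X s $ B *\<^sub>R axis B 1)
      (\<Sum>B\<in>S. X' $ B *\<^sub>R axis B 1 + X 0 $ B *\<^sub>R derivation_ext t (axis B 1))"
    by (intro has_cov_sum has_cov_scaleR comp has_cov_const)
  then have "has_cov X (\<Sum>B\<in>S. X' $ B *\<^sub>R axis B 1 + X 0 $ B *\<^sub>R derivation_ext t (axis B 1))"
    by (rule has_cov_cong) (use support in \<open>auto elim!: eventually_mono simp: X_eq[symmetric]\<close>)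
  \<comment> \<open>Uniqueness expresses the given \<open>D\<close> through the blades of
    \<open>S\<close> and their derivatives; the latter need not lie in the span of these
    blades.\<close>
  with X have D: "D = (\<Sum>B\<in>S. X' $ B *\<^sub>R axis B 1 + X 0 $ B *\<^sub>R derivation_ext t (axis B 1))"
    by (rule has_cov_unique)
  have bil: "bilinear (clifford (m s))" if "linear (m s) \<and> adjoint (m s) = m s" for s
    using is_clifford_product_clifford[of "m s"] that by (auto simp: is_clifford_product_def)
  have bil0: "bilinear (clifford (m 0))" using bil metric_0 by blast
  have sum_left: "f (\<Sum>B\<in>S. h B) Z = (\<Sum>B\<in>S. f (h B) Z)"
    if "bilinear f" for f :: "'n mv \<Rightarrow> 'n mv \<Rightarrow> 'n mv" and h Z
    using that linear_sum[of "\<lambda>x. f x Z" h S] by (simp add: bilinear_def)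
  have "has_cov (\<lambda>s. \<Sum>B\<in>S. X s $ B *\<^sub>R clifford (m s) (axis B 1) (Y s))
      (\<Sum>B\<in>S. X' $ B *\<^sub>R clifford (m 0) (axis B 1) (Y 0) + X 0 $ B *\<^sub>R
         (clifford (m 0) (derivation_ext t (axis B 1)) (Y 0) + clifford (m 0) (axis B 1) E))"
    by (intro has_cov_sum has_cov_scaleR comp basis Y)
  also have "(\<Sum>B\<in>S. X' $ B *\<^sub>R clifford (m 0) (axis B 1) (Y 0) + X 0 $ B *\<^sub>R
         (clifford (m 0) (derivation_ext t (axis B 1)) (Y 0) + clifford (m 0) (axis B 1) E)) =
      clifford (m 0) D (Y 0) + clifford (m 0) (\<Sum>B\<in>S. X 0 $ B *\<^sub>R axis B 1) E"
    unfolding D sum_left[OF bil0]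
    by (simp add: bilinear_ladd[OF bil0] bilinear_lmul[OF bil0] scaleR_add_right sum.distrib)
  also have "(\<Sum>B\<in>S. X 0 $ B *\<^sub>R axis B 1) = X 0"
    using X_eq eventually_nhds_x_imp_x[OF support] by metis
  finally have "has_cov (\<lambda>s. \<Sum>B\<in>S. X s $ B *\<^sub>R clifford (m s) (axis B 1) (Y s))
      (clifford (m 0) D (Y 0) + clifford (m 0) (X 0) E)" .
  then show ?thesis
  proof (rule has_cov_cong)
    show "\<forall>\<^sub>F s in nhds 0. (\<Sum>B\<in>S. X s $ B *\<^sub>R clifford (m s) (axis B 1) (Y s)) = clifford (m s) (X s) (Y s)"
      using metric support
    proof eventually_elim
      case (elim s)
      then have "clifford (m s) (X s) (Y s) = clifford (m s) (\<Sum>B\<in>S. X s $ B *\<^sub>R axis B 1) (Y s)"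
        using X_eq[of "X s"] by simp
      with elim(1) show ?case
        by (simp add: sum_left[OF bil] bilinear_lmul[OF bil])
    qed
  qed
qed

text \<open>Induction on the grade. With \<open>A = insert i A'\<close> and \<open>e\<close> the
  vector of \<open>i\<close>, the product of \<open>e \<and> A'\<close> with \<open>Y\<close> is
  \<open>e\<close> times \<open>A' Y\<close> minus the product of the contraction of
  \<open>A'\<close> by \<open>e\<close> with \<open>Y\<close>. The first is a contraction plus an
  exterior product, with known rules, and the last has a left factor of lower grade.\<close>

lemma has_cov_clifford_axis:
  assumes "has_cov Y E"
  shows "has_cov (\<lambda>s. clifford (m s) (axis A 1) (Y s))
    (clifford (m 0) (derivation_ext t (axis A 1)) (Y 0) + clifford (m 0) (axis A 1) E)"
  using assms
proof (induction "card A" arbitrary: A Y E rule: less_induct)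
  case less
  let ?C = "\<lambda>s. clifford (m s)"
  have cliff: "is_clifford_product (m s) (?C s)" if "linear (m s) \<and> adjoint (m s) = m s" for s
    using is_clifford_product_clifford that by blast
  note C = cliff[unfolded is_clifford_product_def]
  have C0: "is_clifford_product (m 0) (?C 0)" using cliff metric_0 by blast
  have bil0: "bilinear (?C 0)" using C0 by (simp add: is_clifford_product_def)
  note bil0_simps = bilinear_ladd[OF bil0] bilinear_radd[OF bil0] bilinear_lsub[OF bil0]
    bilinear_rsub[OF bil0] bilinear_lmul[OF bil0] bilinear_rmul[OF bil0] bilinear_lzero[OF bil0]
  show ?case
  proof (cases "A = {}")
    case True
    have one: "axis {} 1 = mv_scalar 1" by (simp add: mv_scalar_def)
    have "has_cov (\<lambda>s. ?C s (axis A 1) (Y s)) E"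
    proof (rule has_cov_cong[OF less.prems])
      show "\<forall>\<^sub>F s in nhds 0. Y s = ?C s (axis A 1) (Y s)"
        using metric by eventually_elim (use C in \<open>simp add: True one\<close>)
    qed
    then show ?thesis
      using C0 by (simp add: True one derivation_ext_scalar bil0_simps is_clifford_product_def)
  next
    case False
    then obtain i A' where A: "A = insert i A'" "i \<notin> A'"
      by (metis all_not_in_conv mk_disjoint_insert)
    let ?e = "mv_vector (axis i 1)" and ?d = "derivation_ext t"
    define K where "K = (\<lambda>s. metric_lcontr (m s) ?e (axis A' 1))"
    define K' where "K' = metric_lcontr (m 0) (?d ?e) (axis A' 1) +
        metric_lcontr (m 0) ?e (?d (axis A' 1))"
    have lt: "card B < card A" if "B \<subseteq> A'" for B
      using A that by (intro psubset_card_mono) auto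
    have K: "has_cov K K'"
      unfolding K_def K'_def by (intro has_cov_metric_lcontr has_cov_const)
    \<comment> \<open>Contraction by a vector only removes indices, so \<open>K s\<close> is a
      combination of blades over subsets of \<open>A'\<close>, to which the induction hypothesis
      applies.\<close>
    have "\<forall>\<^sub>F s in nhds 0. \<forall>B. B \<notin> Pow A' \<longrightarrow> K s $ B = 0"
      using metric
    proof eventually_elim
      case (elim s)
      have "mv_vector (m s (axis i 1)) \<lrcorner> axis A' 1 \<in> {X. \<forall>B. B \<notin> Pow A' \<longrightarrow> X $ B = 0}"
        by (rule lcontr_vector_axis_in) (auto simp: subspace_def axis_def)
      moreover have "K s = mv_vector (m s (axis i 1)) \<lrcorner> axis A' 1"
        using elim by (simp only: K_def metric_lcontr_def outermorphism_vector)
      ultimately show ?case by simp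
    qed
    then have KY: "has_cov (\<lambda>s. ?C s (K s) (Y s)) (?C 0 K' (Y 0) + ?C 0 (K 0) E)"
      by (rule has_cov_clifford_combination[rotated])
        (auto intro!: less.hyps lt K less.prems)
    let ?W = "\<lambda>s. ?C s (axis A' 1) (Y s)"
    let ?W' = "?C 0 (?d (axis A' 1)) (Y 0) + ?C 0 (axis A' 1) E"
    have "has_cov ?W ?W'" by (rule less.hyps[OF lt less.prems]) simp
    then have prod: "has_cov (\<lambda>s. metric_lcontr (m s) ?e (?W s) + ?e \<^bold>\<and> ?W s - ?C s (K s) (Y s))
       (metric_lcontr (m 0) (?d ?e) (?W 0) + metric_lcontr (m 0) ?e ?W' +
         (?d ?e \<^bold>\<and> ?W 0 + ?e \<^bold>\<and> ?W') - (?C 0 K' (Y 0) + ?C 0 (K 0) E))" (is "has_cov _ ?D")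
      by (intro has_cov_diff has_cov_add has_cov_metric_lcontr has_cov_wedge has_cov_const KY)
    have mult: "metric_lcontr (m s) (mv_vector b) Z + mv_vector b \<^bold>\<and> Z = ?C s (mv_vector b) Z"
      if "linear (m s) \<and> adjoint (m s) = m s" for s b Z
      using C[OF that] by simp
    have assoc: "?C s X (?C s Y Z) = ?C s (?C s X Y) Z"
      if "linear (m s) \<and> adjoint (m s) = m s" for s X Y Z
      using C[OF that] by simp
    have wedge: "?C s (?C s (mv_vector b) X) Z - ?C s (metric_lcontr (m s) (mv_vector b) X) Z =
        ?C s (mv_vector b \<^bold>\<and> X) Z" if "linear (m s) \<and> adjoint (m s) = m s" for s b X Z
      using C[OF that] by (simp flip: bilinear_lsub)
    have m0: "linear (m 0) \<and> adjoint (m 0) = m 0" using metric_0 by blast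
    \<comment> \<open>The terms are grouped by whether the derivative falls on \<open>e\<close>, on
      the blade of \<open>A'\<close> or on \<open>Y\<close>; in each group the Clifford product
      minus the contraction leaves the exterior product.\<close>
    have D_eq: "?D = ?C 0 (?d (?e \<^bold>\<and> axis A' 1)) (Y 0) + ?C 0 (?e \<^bold>\<and> axis A' 1) E"
    proof -
      have "?D = (metric_lcontr (m 0) (?d ?e) (?W 0) + ?d ?e \<^bold>\<and> ?W 0)
          + (metric_lcontr (m 0) ?e ?W' + ?e \<^bold>\<and> ?W') - (?C 0 K' (Y 0) + ?C 0 (K 0) E)"
        by simp
      also have "\<dots> = (?C 0 (?C 0 (?d ?e) (axis A' 1)) (Y 0)
            - ?C 0 (metric_lcontr (m 0) (?d ?e) (axis A' 1)) (Y 0))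
          + (?C 0 (?C 0 ?e (?d (axis A' 1))) (Y 0)
            - ?C 0 (metric_lcontr (m 0) ?e (?d (axis A' 1))) (Y 0))
          + (?C 0 (?C 0 ?e (axis A' 1)) E - ?C 0 (metric_lcontr (m 0) ?e (axis A' 1)) E)"
        unfolding derivation_ext_vector[OF linear_t] mult[OF m0] K_def K'_def
        by (simp add: assoc[OF m0] bil0_simps derivation_ext_vector[OF linear_t] del: mv_vector_axis)
      also have "\<dots> = ?C 0 (?d (?e \<^bold>\<and> axis A' 1)) (Y 0) + ?C 0 (?e \<^bold>\<and> axis A' 1) E"
        unfolding derivation_ext_vector[OF linear_t] wedge[OF m0]
        by (simp add: derivation_ext_wedge_vector[OF linear_t] bil0_simps del: mv_vector_axis)
      finally show ?thesis .
    qed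
    have "\<forall>\<^sub>F s in nhds 0. metric_lcontr (m s) ?e (?W s) + ?e \<^bold>\<and> ?W s - ?C s (K s) (Y s) =
        ?C s (?e \<^bold>\<and> axis A' 1) (Y s)"
      using metric by eventually_elim (simp only: mult assoc K_def wedge)
    then have "has_cov (\<lambda>s. ?C s (?e \<^bold>\<and> axis A' 1) (Y s))
        (?C 0 (?d (?e \<^bold>\<and> axis A' 1)) (Y 0) + ?C 0 (?e \<^bold>\<and> axis A' 1) E)"
      by (rule has_cov_cong[OF prod[unfolded D_eq]])
    moreover have "?e \<^bold>\<and> axis A' 1 = wedge_sign {i} A' *\<^sub>R axis A 1"
      using A by (simp add: wedge_axis)
    ultimately have *: "has_cov (\<lambda>s. ?C s (wedge_sign {i} A' *\<^sub>R axis A 1) (Y s))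
        (wedge_sign {i} A' *\<^sub>R (?C 0 (?d (axis A 1)) (Y 0) + ?C 0 (axis A 1) E))"
      by (simp add: derivation_ext_linear_simps bil0_simps scaleR_add_right)
    \<comment> \<open>The sign is its own inverse, so multiplying by it once more isolates
      \<open>axis A 1\<close>.\<close>
    have "((\<lambda>s. wedge_sign {i} A') has_vector_derivative 0) (at 0)" by simp
    from has_cov_scaleR[OF this *]
    have "has_cov (\<lambda>s. wedge_sign {i} A' *\<^sub>R ?C s (wedge_sign {i} A' *\<^sub>R axis A 1) (Y s))
        (?C 0 (?d (axis A 1)) (Y 0) + ?C 0 (axis A 1) E)"
      by simp
    then show ?thesis
    proof (rule has_cov_cong)
      show "\<forall>\<^sub>F s in nhds 0. wedge_sign {i} A' *\<^sub>R ?C s (wedge_sign {i} A' *\<^sub>R axis A 1) (Y s) =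
          ?C s (axis A 1) (Y s)"
        using metric by eventually_elim (use C in \<open>simp add: bilinear_lmul\<close>)
    qed
  qed
qed

lemma has_cov_clifford:
  assumes "has_cov X D" "has_cov Y E"
  shows "has_cov (\<lambda>s. clifford (m s) (X s) (Y s)) (clifford (m 0) D (Y 0) + clifford (m 0) (X 0) E)"
  by (rule has_cov_clifford_combination[where S = UNIV]) (auto intro: has_cov_clifford_axis assms)

lemma has_cov_suitable_product:
  assumes "P \<in> suitable_products" "has_cov X D" "has_cov Y E"
  shows "has_cov (\<lambda>s. P (m s) (X s) (Y s)) (P (m 0) D (Y 0) + P (m 0) (X 0) E)"
  using assms(1) has_cov_wedge[OF assms(2,3)] has_cov_metric_scalar[OF assms(2,3)]
    has_cov_metric_lcontr[OF assms(2,3)] has_cov_metric_rcontr[OF assms(2,3)]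
    has_cov_clifford[OF assms(2,3)]
  unfolding suitable_products_def by blast

end


subsection \<open>The inverse metric\<close>

lemma differentiable_prod:
  fixes f :: "'i \<Rightarrow> 'a::real_normed_vector \<Rightarrow> 'b::real_normed_field"
  assumes "\<And>i. i \<in> I \<Longrightarrow> f i differentiable (at x within S)"
  shows "(\<lambda>x. \<Prod>i\<in>I. f i x) differentiable (at x within S)"
  using assms by (induction I rule: infinite_finite_induct) auto

lemma differentiable_det:
  fixes A :: "'a::real_normed_vector \<Rightarrow> real^'n^'n"
  assumes "\<And>i j. (\<lambda>x. A x $ i $ j) differentiable (at x within S)"
  shows "(\<lambda>x. det (A x)) differentiable (at x within S)"
  unfolding det_def
  by (intro differentiable_sum ballI differentiable_mult differentiable_prod assms) auto

text \<open>A quotient of determinants in the entries of \<open>f\<close> and \<open>v\<close>; this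
  form carries differentiability from a metric to its inverse.\<close>

lemma inv_eq_cramer:
  fixes f :: "real^'n \<Rightarrow> real^'n"
  assumes "linear f" "det (matrix f) \<noteq> 0"
  shows "inv f v = (\<chi> k. det (\<chi> i j. if j = k then v $ i else f (axis j 1) $ i) / det (matrix f))"
proof -
  have "inj f" using assms det_nz_iff_inj by blast
  then have "surj f" using linear_injective_imp_surjective[OF assms(1)] by simp
  then have "matrix f *v inv f v = v"
    using assms(1) by (simp add: matrix_works surj_f_inv_f)
  then show ?thesis using cramer[OF assms(2), of "inv f v" v]
    by (simp add: matrix_def cong: if_cong)
qed

context compatible_curve
begin

text \<open>Differentiating \<open>m s (h s) = v\<close> for \<open>h s = inv (m s) v\<close> and
  solving for the derivative of \<open>h\<close> gives the compatibility equation with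
  \<open>t\<close> replaced by minus its adjoint, whose own adjoint is \<open>- t\<close>.\<close>

lemma compatible_curve_inverse:
  assumes det: "\<forall>\<^sub>F s in nhds 0. det (matrix (m s)) \<noteq> 0"
  shows "compatible_curve (\<lambda>s. inv (m s)) (\<lambda>v. - adjoint t v)"
proof (rule compatible_curve.intro)
  have adj: "linear (adjoint t)" by (rule adjoint_linear[OF linear_t])
  show "linear (\<lambda>v. - adjoint t v)" by (rule linear_compose_neg[OF adj])
  have bij: "bij (m s)" if "linear (m s)" "det (matrix (m s)) \<noteq> 0" for s
    using that det_nz_iff_inj linear_injective_imp_surjective unfolding bij_def by blast
  have lin_inv: "linear (inv (m s))" if "linear (m s)" "det (matrix (m s)) \<noteq> 0" for s
    using bij[OF that] that(1) by (metis bij_def inj_linear_imp_inv_linear)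
  show "\<forall>\<^sub>F s in nhds 0. linear (inv (m s)) \<and> adjoint (inv (m s)) = inv (m s)"
    using metric det
  proof eventually_elim
    case (elim s)
    then have b: "bij (m s)" and l: "linear (m s)" using bij by auto
    have "inv (m s) x \<bullet> y = x \<bullet> inv (m s) y" for x y
      using adjoint_clauses(1)[OF l, of "inv (m s) x" "inv (m s) y"] elim b
      by (simp add: bij_inv_eq_iff bij_is_surj surj_f_inv_f)
    then have "adjoint (inv (m s)) = inv (m s)" by (intro adjoint_unique) simp
    with lin_inv elim show ?case by blast
  qed
  fix v
  define h where "h = (\<lambda>s. inv (m s) v)"
  note det0 = eventually_nhds_x_imp_x[OF det]
  have entry: "(\<lambda>s. m s w $ i) differentiable (at 0)" for w i
    using bounded_linear.has_vector_derivative[OF bounded_linear_vec_nth compatible[of w]]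
    by (rule differentiableI_vector)
  have column: "(\<lambda>s. if j = k then v $ i else m s (axis j 1) $ i) differentiable (at 0)" for i j k
    by (cases "j = k") (simp_all add: entry)
  \<comment> \<open>The coordinates of \<open>inv (m s) v\<close> by Cramer's rule. They agree with
    \<open>h\<close> only where the metric is linear and invertible, so differentiability is shown
    for \<open>?h\<close> and then transferred.\<close>
  let ?h = "\<lambda>s. \<Sum>k\<in>UNIV. (det (\<chi> i j. if j = k then v $ i else m s (axis j 1) $ i) / det (matrix (m s)))
      *\<^sub>R axis k (1::real)"
  have "?h differentiable (at 0)"
    by (intro differentiable_sum ballI differentiable_scaleR differentiable_divide differentiable_det)
      (simp_all add: matrix_def entry column det0[unfolded matrix_def])
  moreover have h_eq: "\<forall>\<^sub>F s in nhds 0. ?h s = h s"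
    using metric det
  proof eventually_elim
    case (elim s)
    have "h s = (\<Sum>k\<in>UNIV. h s $ k *\<^sub>R axis k 1)"
      by (simp add: vec_eq_iff axis_def if_distrib cong: if_cong)
    with elim show ?case by (simp add: h_def inv_eq_cramer)
  qed
  ultimately obtain h' where "(?h has_vector_derivative h') (at 0)"
    by (auto simp: vector_derivative_works)
  moreover have "(?h has_vector_derivative h') (at 0) = (h has_vector_derivative h') (at 0)"
    by (intro has_vector_derivative_cong_ev)
      (use h_eq eventually_nhds_x_imp_x[OF h_eq] in simp_all)
  ultimately have h': "(h has_vector_derivative h') (at 0)" by simp
  have hk: "((\<lambda>s. h s $ k) has_vector_derivative h' $ k) (at 0)" for k
    by (rule bounded_linear.has_vector_derivative[OF bounded_linear_vec_nth h'])
  have exp: "(\<Sum>k\<in>UNIV. w $ k *\<^sub>R f (axis k 1)) = f w" if "linear f" for w and f :: "'n canon \<Rightarrow> 'n canon"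
    using linear_axis_expand[OF that, of w] by (simp add: inner_axis')
  \<comment> \<open>Compatibility gives derivatives of \<open>m s w\<close> for fixed
    \<open>w\<close> only; hence \<open>m s (h s)\<close> is expanded in the coordinates of
    \<open>h s\<close> before the product rule is applied.\<close>
  have "((\<lambda>s. \<Sum>k\<in>UNIV. h s $ k *\<^sub>R m s (axis k 1)) has_vector_derivative
      (\<Sum>k\<in>UNIV. h 0 $ k *\<^sub>R (adjoint t (m 0 (axis k 1)) + m 0 (t (axis k 1))) +
        h' $ k *\<^sub>R m 0 (axis k 1))) (at 0)"
    by (intro has_vector_derivative_sum
        bounded_bilinear.has_vector_derivative[OF bounded_bilinear_scaleR hk compatible])
  moreover have "\<forall>\<^sub>F s in nhds 0. (\<Sum>k\<in>UNIV. h s $ k *\<^sub>R m s (axis k 1)) = v" (is "eventually ?E _")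
    using metric det
    by eventually_elim (simp add: exp h_def bij bij_is_surj surj_f_inv_f)
  then have "((\<lambda>s. \<Sum>k\<in>UNIV. h s $ k *\<^sub>R m s (axis k 1)) has_vector_derivative D) (at 0) =
      ((\<lambda>s. v) has_vector_derivative D) (at 0)" for D
    by (intro has_vector_derivative_cong_ev) (use eventually_nhds_x_imp_x[of ?E] in simp_all)
  ultimately have "((\<lambda>s. v) has_vector_derivative
      (\<Sum>k\<in>UNIV. h 0 $ k *\<^sub>R (adjoint t (m 0 (axis k 1)) + m 0 (t (axis k 1))) +
        h' $ k *\<^sub>R m 0 (axis k 1))) (at 0)"
    by blast
  then have "(\<Sum>k\<in>UNIV. h 0 $ k *\<^sub>R (adjoint t (m 0 (axis k 1)) + m 0 (t (axis k 1))) +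
        h' $ k *\<^sub>R m 0 (axis k 1)) = 0"
    using vector_derivative_unique_at[OF _ has_vector_derivative_const] by blast
  moreover have "linear (\<lambda>w. adjoint t (m 0 w))" "linear (\<lambda>w. m 0 (t w))"
    using linear_compose[OF metric_0(1) adj] linear_compose[OF linear_t metric_0(1)] by (auto simp: o_def)
  ultimately have 0: "adjoint t (m 0 (h 0)) + m 0 (t (h 0)) + m 0 h' = 0"
    using exp[of "\<lambda>w. adjoint t (m 0 w)" "h 0"] exp[of "\<lambda>w. m 0 (t w)" "h 0"] exp[OF metric_0(1), of h']
    by (simp add: sum.distrib scaleR_add_right)
  have b0: "bij (m 0)" using bij metric_0 det0 by blast
  have l0: "linear (inv (m 0))" using lin_inv metric_0 det0 by blast
  have "m 0 (h 0) = v" using b0 by (simp add: h_def bij_is_surj surj_f_inv_f)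
  with 0 have "m 0 h' + (adjoint t v + m 0 (t (h 0))) = 0" by (simp add: add.commute)
  then have "m 0 h' = - (adjoint t v + m 0 (t (h 0)))" by (simp only: eq_neg_iff_add_eq_0)
  then have "h' = inv (m 0) (- (adjoint t v + m 0 (t (h 0))))"
    using b0 by (metis bij_inv_eq_iff)
  also have "\<dots> = - inv (m 0) (adjoint t v) - t (h 0)"
    using b0 by (simp add: linear_neg[OF l0] linear_add[OF l0] linear_diff[OF l0] bij_is_inj)
  finally have "h' = - t (h 0) + inv (m 0) (- adjoint t v)"
    by (simp add: linear_neg[OF l0])
  moreover have "adjoint (\<lambda>v. - adjoint t v) = (\<lambda>v. - t v)"
    by (rule adjoint_unique) (simp add: adjoint_clauses[OF linear_t])
  ultimately show "((\<lambda>s. inv (m s) v) has_vector_derivative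
      adjoint (\<lambda>v. - adjoint t v) (inv (m 0) v) + inv (m 0) (- adjoint t v)) (at 0)"
    using h' by (simp add: h_def)
qed

end

text \<open>Lets the sum over the coordinate directions pass through a product taken at a fixed
  point.\<close>

lemma bilinear_suitable_product:
  assumes P: "P \<in> suitable_products" and m: "linear m" "adjoint m = m"
  shows "bilinear (P m)"
proof -
  have "bilinear (\<lambda>X Y. mv_scalar (metric_scalar m X Y))"
    by (auto intro!: linearI simp: bilinear_def metric_scalar_def mv_scalar_eq inner_left_distrib
        inner_right_distrib scaleR_add_left linear_add[OF linear_outermorphism]
        linear_scale[OF linear_outermorphism])
  moreover have "bilinear (metric_lcontr m)"
    by (auto intro!: linearI simp: bilinear_def metric_lcontr_def lcontr_linear_simps
        linear_add[OF linear_outermorphism] linear_scale[OF linear_outermorphism])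
  moreover have "bilinear (metric_rcontr m)"
    by (auto intro!: linearI simp: bilinear_def metric_rcontr_def linear_add[OF linear_outermorphism]
        linear_scale[OF linear_outermorphism] bilinear_ladd[OF bilinear_rcontr] bilinear_radd[OF bilinear_rcontr]
      bilinear_lmul[OF bilinear_rcontr] bilinear_rmul[OF bilinear_rcontr])
  moreover have "bilinear (clifford m)"
    using is_clifford_product_clifford[OF m] by (simp add: is_clifford_product_def)
  ultimately show ?thesis
    using P bilinear_wedge unfolding suitable_products_def by blast
qed


subsection \<open>Covariant derivatives along coordinate lines\<close>

text \<open>The curve along which \<open>chart_partial\<close> differentiates. It is meaningful only
  while the coordinates stay in the image of the chart, hence the statements near \<open>0\<close>
  that follow.\<close>

definition coordinate_line :: "('m, 'n::finite) chart \<Rightarrow> 'n \<Rightarrow> 'm \<Rightarrow> real \<Rightarrow> 'm" where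
  "coordinate_line c \<mu> p s = chart_inv c (chart_map c p + s *\<^sub>R axis \<mu> 1)"

lemma chart_inv_chart_map:
  assumes "is_chart M c" "p \<in> chart_dom c"
  shows "chart_inv c (chart_map c p) = p"
proof -
  have "topspace (subtopology M (chart_dom c)) = chart_dom c"
    using assms(1) openin_subset[of M "chart_dom c"] by (auto simp: is_chart_def)
  then have "inj_on (chart_map c) (chart_dom c)"
    using assms(1) homeomorphic_imp_injective_map by (fastforce simp: is_chart_def)
  with assms(2) show ?thesis by (simp add: chart_inv_def)
qed

text \<open>The chart is a homeomorphism onto an open set, so the image of \<open>U\<close> is open
  in coordinate space, and the straight line through the image of \<open>p\<close> stays in it for
  small parameters.\<close>

lemma eventually_coordinate_line_in:
  assumes c: "is_chart M c" and U: "openin M U" "U \<subseteq> chart_dom c" and p: "p \<in> U"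
  shows "\<forall>\<^sub>F s in nhds 0. coordinate_line c \<mu> p s \<in> U"
proof -
  have "openin (subtopology M (chart_dom c)) U"
    using U by (auto simp: openin_subtopology)
  then have "openin (top_of_set (chart_map c ` chart_dom c)) (chart_map c ` U)"
    using c homeomorphic_map_openness_eq unfolding is_chart_def by blast
  then have "open (chart_map c ` U)"
    using c by (auto simp: is_chart_def openin_open_eq)
  moreover have "((\<lambda>s. chart_map c p + s *\<^sub>R axis \<mu> 1) \<longlongrightarrow> chart_map c p + 0 *\<^sub>R axis \<mu> 1) (nhds 0)"
    by (intro tendsto_intros filterlim_ident)
  ultimately have "\<forall>\<^sub>F s in nhds 0. chart_map c p + s *\<^sub>R axis \<mu> 1 \<in> chart_map c ` U"
    using p by (auto simp: topological_tendstoD)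
  then show ?thesis
    by eventually_elim (use U c chart_inv_chart_map in \<open>fastforce simp: coordinate_line_def\<close>)
qed

text \<open>Smoothness at order one, read in the chart \<open>c\<close>, gives a Frechet derivative
  at the coordinates of \<open>p\<close>; the chain rule with the affine line does the rest.\<close>

lemma has_vector_derivative_coordinate_line:
  assumes "smooth_map_on \<A> U X" "c \<in> \<A>" "U \<subseteq> chart_dom c" "p \<in> U"
  shows "((\<lambda>s. X (coordinate_line c \<mu> p s)) has_vector_derivative chart_partial c \<mu> X p) (at 0)"
proof -
  have "Ck_on 1 (chart_map c ` (U \<inter> chart_dom c)) (X \<circ> chart_inv c)"
    using assms(1,2) unfolding smooth_map_on_def smooth_on_def by blast
  then have "(X \<circ> chart_inv c) differentiable (at (chart_map c p))"
    using assms(3,4) by auto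
  moreover have "(\<lambda>s. chart_map c p + s *\<^sub>R axis \<mu> (1::real)) differentiable (at 0)"
    by (intro derivative_intros)
  ultimately have "((X \<circ> chart_inv c) \<circ> (\<lambda>s. chart_map c p + s *\<^sub>R axis \<mu> 1)) differentiable (at 0)"
    by (intro differentiable_chain_at) auto
  then show ?thesis
    by (simp add: vector_derivative_works chart_partial_def coordinate_line_def o_def)
qed

section \<open>Connection terms as derivations, and linearity in the direction\<close>

lemma Gam_eq_derivation_ext: "Gam \<gamma> a p = derivation_ext (blinfun_apply (blinfun_apply (\<gamma> p) a))"
  by (simp add: fun_eq_iff Gam_def derivation_ext_def)

lemma linear_blinfun_apply: "linear (blinfun_apply f)"
  by (simp add: bounded_linear.linear blinfun.bounded_linear_right)

lemma dir_deriv_axis: "dir_deriv c (axis \<mu> 1) X p = chart_partial c \<mu> X p"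
  by (simp add: dir_deriv_def inner_axis_axis if_distrib[of "\<lambda>r. r *\<^sub>R _"] cong: if_cong)

lemma Gam_sum: "Gam \<gamma> a p X = (\<Sum>\<mu>\<in>UNIV. (a \<bullet> axis \<mu> 1) *\<^sub>R Gam \<gamma> (axis \<mu> 1) p X)"
proof -
  have "linear (\<lambda>a. Gam \<gamma> a p X)"
    unfolding Gam_def
    by (auto intro!: linearI simp: wedge_linear_simps mv_vector_linear_simps blinfun.add_left
        blinfun.add_right blinfun.scaleR_left blinfun.scaleR_right sum.distrib scaleR_sum_right)
  then have "Gam \<gamma> (\<Sum>\<mu>\<in>UNIV. (a \<bullet> axis \<mu> 1) *\<^sub>R axis \<mu> 1) p X =
      (\<Sum>\<mu>\<in>UNIV. (a \<bullet> axis \<mu> 1) *\<^sub>R Gam \<gamma> (axis \<mu> 1) p X)"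
    by (simp add: linear_sum[of "\<lambda>a. Gam \<gamma> a p X"] linear_scale[of "\<lambda>a. Gam \<gamma> a p X"])
  then show ?thesis using sum_axis_expand[of a] by (simp add: inner_commute)
qed

text \<open>Reduces an arbitrary direction \<open>a\<close> to the coordinate directions, where a
  single curve through \<open>p\<close> suffices.\<close>

lemma nabla_plus_sum:
  "nabla_plus c \<gamma> a X p = (\<Sum>\<mu>\<in>UNIV. (a \<bullet> axis \<mu> 1) *\<^sub>R nabla_plus c \<gamma> (axis \<mu> 1) X p)"
  unfolding nabla_plus_def dir_deriv_axis scaleR_add_right sum.distrib
  by (simp only: dir_deriv_def Gam_sum[of \<gamma> a])

lemma nabla_minus_sum:
  "nabla_minus c \<gamma> a X p = (\<Sum>\<mu>\<in>UNIV. (a \<bullet> axis \<mu> 1) *\<^sub>R nabla_minus c \<gamma> (axis \<mu> 1) X p)"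
proof -
  have lin: "linear (Gam \<gamma> b p)" for b
    by (simp add: Gam_eq_derivation_ext linear_derivation_ext)
  have "adjoint (Gam \<gamma> a p) (X p) = (\<Sum>\<mu>\<in>UNIV. (a \<bullet> axis \<mu> 1) *\<^sub>R adjoint (Gam \<gamma> (axis \<mu> 1) p) (X p))"
    by (rule mv_eqI)
      (simp add: adjoint_clauses[OF lin] inner_sum_left inner_sum_right Gam_sum[of \<gamma> a])
  then show ?thesis
    unfolding nabla_minus_def dir_deriv_axis scaleR_diff_right sum_subtractf
    by (simp only: dir_deriv_def)
qed

section \<open>Metric compatibility along a coordinate line\<close>

lemma smooth_map_on_const:
  fixes \<A> :: "('m, 'n::finite) chart set" and v :: "'b::real_normed_vector"
  shows "smooth_map_on \<A> U (\<lambda>q. v)"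
proof -
  have "Ck_on k S (\<lambda>x. v)" for k and v :: 'b and S :: "'n canon set"
    by (induction k arbitrary: v) (auto simp: frechet_derivative_const)
  then show ?thesis by (simp add: smooth_map_on_def smooth_on_def o_def)
qed

lemma mv_vector_inject: "mv_vector v = mv_vector w \<longleftrightarrow> v = (w :: 'n::{finite,linorder} canon)"
proof -
  have "mv_vector v $ {i} = v $ i" for v :: "'n canon" and i
    by (simp add: mv_vector_def axis_def if_distrib cong: if_cong)
  then show ?thesis by (metis vec_eq_iff)
qed


lemma derivation_ext_uminus: "derivation_ext (\<lambda>v. - t v) X = - derivation_ext t X"
  by (simp add: derivation_ext_def mv_vector_linear_simps wedge_linear_simps sum_negf
      del: mv_vector_axis)

lemma coordinate_line_0:
  assumes "is_chart M c" "p \<in> chart_dom c"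
  shows "coordinate_line c \<mu> p 0 = p"
  using chart_inv_chart_map[OF assms] by (simp add: coordinate_line_def)

lemma metric_compatible_curve:
  assumes c: "is_chart M c" "c \<in> \<A>" and U: "openin M U" "U \<subseteq> chart_dom c" and p: "p \<in> U"
    and g: "metric_field \<A> U g"
    and compatible: "metric_compatible \<A> U g (nabla_plus c \<gamma>) (nabla_minus c \<gamma>)"
  shows "compatible_curve (\<lambda>s. blinfun_apply (g (coordinate_line c \<mu> p s)))
     (blinfun_apply (blinfun_apply (\<gamma> p) (axis \<mu> 1)))"
proof (rule compatible_curve.intro)
  let ?t = "blinfun_apply (blinfun_apply (\<gamma> p) (axis \<mu> 1))"
  have p0: "coordinate_line c \<mu> p 0 = p"
    by (rule coordinate_line_0[OF c(1)]) (use U(2) p in auto)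
  show "linear ?t" by (rule linear_blinfun_apply)
  then have adj: "linear (adjoint ?t)" by (rule adjoint_linear)
  show "\<forall>\<^sub>F s in nhds 0. linear (blinfun_apply (g (coordinate_line c \<mu> p s))) \<and>
      adjoint (blinfun_apply (g (coordinate_line c \<mu> p s))) = blinfun_apply (g (coordinate_line c \<mu> p s))"
    using eventually_coordinate_line_in[OF c(1) U p]
    by eventually_elim (use g in \<open>auto simp: metric_field_def linear_blinfun_apply\<close>)
  fix v
  let ?g' = "chart_partial c \<mu> g p"
  have g': "((\<lambda>s. blinfun_apply (g (coordinate_line c \<mu> p s)) v) has_vector_derivative ?g' v) (at 0)"
    by (rule bounded_linear.has_vector_derivative[OF blinfun.bounded_linear_left
          has_vector_derivative_coordinate_line[OF _ c(2) U(2) p]])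
      (use g in \<open>simp add: metric_field_def\<close>)
  then have "((\<lambda>s. mv_vector (blinfun_apply (g (coordinate_line c \<mu> p s)) v)) has_vector_derivative
      mv_vector (?g' v)) (at 0)"
    by (rule bounded_linear.has_vector_derivative[rotated])
      (simp add: linear_mv_vector linear_conv_bounded_linear[symmetric])
  then have "chart_partial c \<mu> (\<lambda>q. mv_vector (blinfun_apply (g q) v)) p = mv_vector (?g' v)"
    by (simp add: chart_partial_def coordinate_line_def vector_derivative_at)
  moreover have "chart_partial c \<mu> (\<lambda>q. mv_vector v) p = 0"
    by (simp add: chart_partial_def)
  \<comment> \<open>Compatibility is tested on the constant field \<open>v\<close>: its partial
    derivative vanishes, so the plus operator contributes only the connection term, and the minus
    operator gives the derivative of the metric on \<open>v\<close> minus the adjoint term.\<close>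
  moreover have "nabla_minus c \<gamma> (axis \<mu> 1) (\<lambda>q. mv_vector (blinfun_apply (g q) v)) p =
      outermorphism (g p) (nabla_plus c \<gamma> (axis \<mu> 1) (\<lambda>q. mv_vector v) p)"
    using compatible[unfolded metric_compatible_def, THEN spec[of _ "\<lambda>q. v"], THEN spec[of _ "axis \<mu> 1"]]
      smooth_map_on_const[of \<A> U v] p
    by simp
  ultimately have "mv_vector (?g' v) - mv_vector (adjoint ?t (g p v)) = mv_vector (g p (?t v))"
    by (simp add: nabla_minus_def nabla_plus_def dir_deriv_axis Gam_eq_derivation_ext
        adjoint_derivation_ext derivation_ext_vector adj linear_blinfun_apply outermorphism_vector)
  then have "?g' v = adjoint ?t (g p v) + g p (?t v)"
    by (simp add: mv_vector_inject algebra_simps flip: mv_vector_linear_simps(4))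
  with g' show "((\<lambda>s. blinfun_apply (g (coordinate_line c \<mu> p s)) v) has_vector_derivative
      adjoint ?t (blinfun_apply (g (coordinate_line c \<mu> p 0)) v) +
      blinfun_apply (g (coordinate_line c \<mu> p 0)) (?t v)) (at 0)"
    by (simp add: p0)
qed

theorem mainTheorem10:
  fixes M :: "'m topology"
    and \<A> :: "('m, 'n::{finite,linorder}) chart set"
    and c\<^sub>o :: "('m, 'n) chart"
    and U :: "'m set"
    and \<gamma> :: "('m, 'n) conn"
    and g :: "('m, 'n) endo_field"
    and X Y :: "'m \<Rightarrow> 'n mv"
    and a :: "'n canon"
  assumes "smooth_manifold M \<A>" and "c\<^sub>o \<in> \<A>"
    and "openin M U" and "U \<subseteq> chart_dom c\<^sub>o"
    and "connection_field \<A> U \<gamma>"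
    and "metric_field \<A> U g"
    and "metric_compatible \<A> U g (nabla_plus c\<^sub>o \<gamma>) (nabla_minus c\<^sub>o \<gamma>)"
    and "smooth_map_on \<A> U X" and "smooth_map_on \<A> U Y"
    and "P \<in> suitable_products" and "p \<in> U"
  shows "nabla_plus c\<^sub>o \<gamma> a (\<lambda>q. P (blinfun_apply (g q)) (X q) (Y q)) p
           = P (blinfun_apply (g p)) (nabla_plus c\<^sub>o \<gamma> a X p) (Y p)
           + P (blinfun_apply (g p)) (X p) (nabla_plus c\<^sub>o \<gamma> a Y p)
       \<and> nabla_minus c\<^sub>o \<gamma> a (\<lambda>q. P (inv (blinfun_apply (g q))) (X q) (Y q)) p
           = P (inv (blinfun_apply (g p))) (nabla_minus c\<^sub>o \<gamma> a X p) (Y p)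
           + P (inv (blinfun_apply (g p))) (X p) (nabla_minus c\<^sub>o \<gamma> a Y p)"
proof -
  let ?c = "c\<^sub>o" and ?L = "\<lambda>\<mu>. coordinate_line c\<^sub>o \<mu> p"
  let ?t = "\<lambda>\<mu>. blinfun_apply (blinfun_apply (\<gamma> p) (axis \<mu> 1))"
  have c: "is_chart M ?c" using assms(1,2) by (simp add: smooth_manifold_def)
  have p0: "?L \<mu> 0 = p" for \<mu>
    by (rule coordinate_line_0[OF c]) (use assms(4,11) in auto)
  have partial: "((\<lambda>s. Z (?L \<mu> s)) has_vector_derivative chart_partial ?c \<mu> Z p) (at 0)"
    if "smooth_map_on \<A> U Z" for Z :: "'m \<Rightarrow> 'n mv" and \<mu>
    by (rule has_vector_derivative_coordinate_line[OF that assms(2,4,11)])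
  have partial_eq: "chart_partial ?c \<mu> Z p = D"
    if "((\<lambda>s. Z (?L \<mu> s)) has_vector_derivative D) (at 0)" for Z :: "'m \<Rightarrow> 'n mv" and \<mu> D
    using vector_derivative_at[OF that] by (simp add: chart_partial_def coordinate_line_def)
  have plus: "compatible_curve (\<lambda>s. blinfun_apply (g (?L \<mu> s))) (?t \<mu>)" for \<mu>
    by (rule metric_compatible_curve[OF c assms(2-4,11,6,7)])
  have "\<forall>\<^sub>F s in nhds 0. det (matrix (blinfun_apply (g (?L \<mu> s)))) \<noteq> 0" for \<mu>
    using eventually_coordinate_line_in[OF c assms(3,4,11), of \<mu>]
    by eventually_elim (use assms(6) in \<open>simp add: metric_field_def\<close>)
  \<comment> \<open>Passing to the inverse metric turns the endomorphism of the plus operator into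
    that of the minus operator, so both rules are instances of the same curve calculus.\<close>
  then have minus: "compatible_curve (\<lambda>s. inv (blinfun_apply (g (?L \<mu> s)))) (\<lambda>v. - adjoint (?t \<mu>) v)" for \<mu>
    by (rule compatible_curve.compatible_curve_inverse[OF plus])
  have gam: "adjoint (Gam \<gamma> (axis \<mu> 1) p) = derivation_ext (adjoint (?t \<mu>))" for \<mu>
    by (simp add: Gam_eq_derivation_ext adjoint_derivation_ext linear_blinfun_apply)
  have axis_plus: "nabla_plus ?c \<gamma> (axis \<mu> 1) (\<lambda>q. P (blinfun_apply (g q)) (X q) (Y q)) p
      = P (blinfun_apply (g p)) (nabla_plus ?c \<gamma> (axis \<mu> 1) X p) (Y p)
      + P (blinfun_apply (g p)) (X p) (nabla_plus ?c \<gamma> (axis \<mu> 1) Y p)" (is "?D = ?E") for \<mu>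
  proof -
    interpret compatible_curve "\<lambda>s. blinfun_apply (g (?L \<mu> s))" "?t \<mu>" by (rule plus)
    have *: "has_cov (\<lambda>s. Z (?L \<mu> s)) (nabla_plus ?c \<gamma> (axis \<mu> 1) Z p)"
      if "smooth_map_on \<A> U Z" for Z
      using partial[OF that] unfolding has_cov_def
      by (simp add: nabla_plus_def dir_deriv_axis Gam_eq_derivation_ext p0)
    have "has_cov (\<lambda>s. P (blinfun_apply (g (?L \<mu> s))) (X (?L \<mu> s)) (Y (?L \<mu> s))) ?E"
      using has_cov_suitable_product[OF assms(10) *[OF assms(8)] *[OF assms(9)]] by (simp add: p0)
    \<comment> \<open>The product rule contains the differentiability of the product along the line,
      so its partial derivative can be read off and the connection term restored.\<close>
    then show "?D = ?E"
      unfolding has_cov_def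
      by (simp add: nabla_plus_def dir_deriv_axis Gam_eq_derivation_ext p0
          partial_eq[of "\<lambda>q. P (blinfun_apply (g q)) (X q) (Y q)"])
  qed
  have axis_minus: "nabla_minus ?c \<gamma> (axis \<mu> 1) (\<lambda>q. P (inv (blinfun_apply (g q))) (X q) (Y q)) p
      = P (inv (blinfun_apply (g p))) (nabla_minus ?c \<gamma> (axis \<mu> 1) X p) (Y p)
      + P (inv (blinfun_apply (g p))) (X p) (nabla_minus ?c \<gamma> (axis \<mu> 1) Y p)" (is "?D = ?E") for \<mu>
  proof -
    interpret compatible_curve "\<lambda>s. inv (blinfun_apply (g (?L \<mu> s)))" "\<lambda>v. - adjoint (?t \<mu>) v"
      by (rule minus)
    have *: "has_cov (\<lambda>s. Z (?L \<mu> s)) (nabla_minus ?c \<gamma> (axis \<mu> 1) Z p)"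
      if "smooth_map_on \<A> U Z" for Z
      using partial[OF that] unfolding has_cov_def
      by (simp add: nabla_minus_def dir_deriv_axis gam derivation_ext_uminus p0)
    have "has_cov (\<lambda>s. P (inv (blinfun_apply (g (?L \<mu> s)))) (X (?L \<mu> s)) (Y (?L \<mu> s))) ?E"
      using has_cov_suitable_product[OF assms(10) *[OF assms(8)] *[OF assms(9)]] by (simp add: p0)
    then show "?D = ?E"
      unfolding has_cov_def
      by (simp add: nabla_minus_def dir_deriv_axis gam derivation_ext_uminus p0
          partial_eq[of "\<lambda>q. P (inv (blinfun_apply (g q))) (X q) (Y q)"])
  qed
  \<comment> \<open>Recombines the rules for the coordinate directions into the rule for
    \<open>a\<close>.\<close>
  have sum: "(\<Sum>\<mu>\<in>UNIV. (a \<bullet> axis \<mu> 1) *\<^sub>R (B (D \<mu>) (Y p) + B (X p) (E \<mu>))) =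
      B (\<Sum>\<mu>\<in>UNIV. (a \<bullet> axis \<mu> 1) *\<^sub>R D \<mu>) (Y p) + B (X p) (\<Sum>\<mu>\<in>UNIV. (a \<bullet> axis \<mu> 1) *\<^sub>R E \<mu>)"
    if "bilinear B" for B :: "'n mv \<Rightarrow> 'n mv \<Rightarrow> 'n mv" and D E
  proof -
    have l: "linear (\<lambda>Z. B Z (Y p))" and r: "linear (B (X p))"
      using that by (auto simp: bilinear_def)
    show ?thesis
      by (simp add: scaleR_add_right sum.distrib linear_sum[OF l] linear_scale[OF l]
          linear_sum[OF r] linear_scale[OF r])
  qed
  have bil: "bilinear (P (blinfun_apply (g p)))" "bilinear (P (inv (blinfun_apply (g p))))"
    using bilinear_suitable_product[OF assms(10) compatible_curve.metric_0[OF plus]]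
      bilinear_suitable_product[OF assms(10) compatible_curve.metric_0[OF minus]]
    by (simp_all add: p0)
  show ?thesis
    unfolding nabla_plus_sum[of _ _ a] nabla_minus_sum[of _ _ a] axis_plus axis_minus
    by (intro conjI sum bil)
qed

end
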